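(* Let $N\ge2$ and let $(A_1,\dots,A_N)$ be nonnegative random variables satisfying $P\{\sum_{i}\mathbf{1}\{A_i>0\}\in\{0,1\}\}<1$, $\mathbb{E}[\sum_i\mathbf{1}\{A_i>0\}]>1$, $P\{A_i\in\{0,1\}\ \forall i\}<1$. Let $F_0$ be a distribution function satisfying $(\mathbf{H}_\gamma)$ (see context) for some $\gamma\in(0,2)$, and let $X_0$ have distribution function $F_0$. Assume $\mu(\delta)<\mu(\gamma)$ for some $\delta>\gamma$ with either $1\le\gamma<\delta\le2$ or $\gamma<\delta\le1$. Let $V_t$ be a random variable whose characteristic function is $\phi(t,\cdot)$, the solution of the Cauchy problem in the context with initial datum the characteristic function of $F_0$, and let $V_\infty$ be a random variable with characteristic function $\xi\mapsto\int_{[0,\infty)}\hat g_\gamma(\xi z^{1/\gamma})\zeta_{\infty,\gamma}(dz)$. Then for every $t\ge0$ $$\mathcal{W}_\delta(e^{-\mu(\gamma)t}V_t,V_\infty)^{\max(\delta,1)}\le c\,\mathcal{W}_\delta(X_0,V_\infty)^{\max(\delta,1)}e^{-t\delta[\mu(\gamma)-\mu(\delta)]},$$ with $c=1$ if $\delta\le1$ and $c=2$ otherwise.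
   Context: $\mathcal{Q}(s)=\mathbb{E}[\sum_{j=1}^N A_j^s]-1$ ($0^0=0$), $\mu(s)=\mathcal{Q}(s)/s$. Cauchy problem: $\phi(t,\cdot)$ characteristic functions with $\partial_t\phi(t,\xi)+\phi(t,\xi)=\mathbb{E}[\prod_{i=1}^N\phi(t,A_i\xi)]$, $\phi(0,\cdot)=\phi_0$ (unique solution). $(\mathbf{H}_\gamma)$: if $\gamma=1$: either (a) $\int|v|dF_0<\infty$, $m_0=\int v\,dF_0$, or (b) $F_0$ symmetric, $\lim_{x\to+\infty}x(1-F_0(x))=c_0^+=\lim_{x\to-\infty}|x|F_0(x)$, $0<c_0^+<\infty$. If $\gamma\in(0,1)\cup(1,2)$: $\lim_{x\to+\infty}x^\gamma(1-F_0(x))=c_0^+<\infty$, $\lim_{x\to-\infty}|x|^\gamma F_0(x)=c_0^-<\infty$, $c_0^++c_0^->0$, and $\int v\,dF_0=0$ if $\gamma>1$. $\hat g_\gamma(\xi)$: $e^{im_0\xi}$ if $\gamma=1$, (a); $e^{-\pi c_0^+|\xi|}$ if $\gamma=1$, (b); $\exp\{-k_0|\xi|^\gamma(1-i\eta_0\tan(\pi\gamma/2)\mathrm{sign}\,\xi)\}$ otherwise, with $k_0=(c_0^++c_0^-)\frac{\pi}{2\Gamma(\gamma)\sin(\pi\gamma/2)}$, $\eta_0=\frac{c_0^+-c_0^-}{c_0^++c_0^-}$. $\zeta_{\infty,\gamma}$: the unique probability on $[0,\infty)$ with mean $1$ whose Fourier–Stieltjes transform $v$ solves $v(\xi)=\int_0^1\mathbb{E}[\prod_{i=1}^N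 v(\xi A_i^\gamma\tau^{\mathcal{Q}(\gamma)})]d\tau$. Wasserstein distance of order $\delta>0$: $\mathcal{W}_\delta(X,Y)=\inf(\mathbb{E}|X'-Y'|^\delta)^{1/\max(\delta,1)}$, infimum over all pairs $(X',Y')$ with $X'\overset{d}{=}X$, $Y'\overset{d}{=}Y$ (possibly $+\infty$). *)

theory Defs
  imports "HOL-Probability.Probability"
begin

text \<open>Q(s) = E[sum_i A_i^s] - 1 (with 0^0 = 0, realised by powr), as an extended real,
  and mu(s) = Q(s)/s.\<close>
definition Qfun :: "'a measure \<Rightarrow> nat \<Rightarrow> (nat \<Rightarrow> 'a \<Rightarrow> real) \<Rightarrow> real \<Rightarrow> ereal" where
  "Qfun M N A s = enn2ereal (\<integral>\<^sup>+ \<omega>. (\<Sum>i<N. ennreal (A i \<omega> powr s)) \<partial>M) - 1"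

definition mufun :: "'a measure \<Rightarrow> nat \<Rightarrow> (nat \<Rightarrow> 'a \<Rightarrow> real) \<Rightarrow> real \<Rightarrow> ereal" where
  "mufun M N A s = Qfun M N A s / ereal s"

definition H_gamma :: "real \<Rightarrow> real measure \<Rightarrow> real \<Rightarrow> real \<Rightarrow> bool" where
  "H_gamma \<gamma> mu0 cp cm \<longleftrightarrow>
     (\<gamma> = 1 \<and>
        (integrable mu0 (\<lambda>v. v) \<or>
         (distr mu0 borel uminus = mu0 \<and>
          ((\<lambda>x. x * (1 - cdf mu0 x)) \<longlongrightarrow> cp) at_top \<and>
          ((\<lambda>x. \<bar>x\<bar> * cdf mu0 x) \<longlongrightarrow> cp) at_bot \<and> 0 < cp)))
   \<or> (\<gamma> \<in> {0<..<1} \<union> {1<..<2} \<and>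
        ((\<lambda>x. x powr \<gamma> * (1 - cdf mu0 x)) \<longlongrightarrow> cp) at_top \<and>
        ((\<lambda>x. \<bar>x\<bar> powr \<gamma> * cdf mu0 x) \<longlongrightarrow> cm) at_bot \<and>
        cp + cm > 0 \<and>
        (\<gamma> > 1 \<longrightarrow> integral\<^sup>L mu0 (\<lambda>v. v) = 0))"

text \<open>The function \<open>\<hat>g_gamma\<close>.  For gamma = 1 case (a) is recognised by integrability of mu0
  (cases (a) and (b) are mutually exclusive).\<close>
definition ghat :: "real \<Rightarrow> real measure \<Rightarrow> real \<Rightarrow> real \<Rightarrow> real \<Rightarrow> complex" where
  "ghat \<gamma> mu0 cp cm \<xi> =
     (if \<gamma> = 1 then
        (if integrable mu0 (\<lambda>v. v)
         then exp (\<i> * complex_of_real (integral\<^sup>L mu0 (\<lambda>v. v) * \<xi>))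
         else complex_of_real (exp (- pi * cp * \<bar>\<xi>\<bar>)))
      else
        (let k0 = (cp + cm) * pi / (2 * Gamma \<gamma> * sin (pi * \<gamma> / 2));
             \<eta>0 = (cp - cm) / (cp + cm)
         in exp (- complex_of_real (k0 * \<bar>\<xi>\<bar> powr \<gamma>) *
                 (1 - \<i> * complex_of_real (\<eta>0 * tan (pi * \<gamma> / 2) * sgn \<xi>)))))"

definition couplings :: "real measure \<Rightarrow> real measure \<Rightarrow> (real \<times> real) measure set" where
  "couplings \<mu> \<nu> = {\<pi>. prob_space \<pi> \<and> sets \<pi> = sets (borel :: (real \<times> real) measure) \<and>
                        distr \<pi> borel fst = \<mu> \<and> distr \<pi> borel snd = \<nu>}"

text \<open>Real power on [0,\<infinity>], with \<infinity> ^ p = \<infinity> (used only for p > 0).\<close>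
definition ennpowr :: "ennreal \<Rightarrow> real \<Rightarrow> ennreal" where
  "ennpowr x p = (if x = \<infinity> then \<infinity> else ennreal (enn2real x powr p))"

definition wasserstein :: "real \<Rightarrow> real measure \<Rightarrow> real measure \<Rightarrow> ennreal" where
  "wasserstein \<delta> \<mu> \<nu> =
     ennpowr (INF \<pi> \<in> couplings \<mu> \<nu>. \<integral>\<^sup>+ z. ennreal (\<bar>fst z - snd z\<bar> powr \<delta>) \<partial>\<pi>)
             (1 / max \<delta> 1)"

end

(*
  Both V_t and exp (mu t) V_inf solve the Cauchy problem: the second because the fixed point
  equation of zeta makes the law of V_inf self-similar. A solution of the Cauchy problem is the law
  of a random sum of leaf values over a branching tree: with r = exp (-t) and tau uniform on [0,1],
  the root is a leaf if tau < r; otherwise it has N independent subtrees, run with r / tau and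
  weighted by A_1, ..., A_N.
  Evaluating the same tree on coupled leaf values (X, Y) of X_0 and V_inf couples V_t with
  exp (mu t) V_inf. If E|z + (X - Y)|^delta <= |z|^delta + K for all z, the same holds for the
  difference of the two tree sums with K exp (Q(delta) t) in place of K, by conditioning on the
  root. The bound at a leaf, with K = c E|X - Y|^delta, is subadditivity of |.|^delta if
  delta <= 1; if delta > 1 it is the von Bahr-Esseen inequality, which needs E(X - Y) = 0.
*)
theory Submission
  imports Defs
begin

section \<open>Moment inequalities\<close>

text \<open>For \<open>\<tau>\<close> uniform on [0,1], -ln \<open>\<tau>\<close> is an exponential
  waiting time of rate 1. The test \<open>\<tau> < r\<close> says that this clock rings after time
  t; otherwise the time left is t + ln \<open>\<tau>\<close>, and \<open>r / \<tau>\<close> is exp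
  of minus that. In the variable r the Cauchy problem becomes w r \<open>\<xi>\<close> = r * w 1
  \<open>\<xi>\<close> plus the integral over [r,1] of E prod_i w (r / \<open>\<tau>\<close>) (A_i
  \<open>\<xi>\<close>), and both curves are treated in this form. The solution V is given only
  through its characteristic functions, so its law has to be tied to the tree: every solution of the
  integral equation that is bounded by 1 is shown to be the limit of the characteristic functions of
  trees cut at depth n. This estimate contains the uniqueness of the Cauchy problem. Two obstacles
  shape the rest. The function \<open>ghat\<close> needs the equation of \<open>zeta\<close> at
  complex arguments, although it is given for characteristic functions only. And for
  \<open>\<gamma>\<close> = 1 the variables X and Y need not be integrable, so E(X - Y) = 0 is not
  always a difference of two means.\<close>

lemma powr_add_le:
  fixes x y :: real
  assumes "0 \<le> x" "0 \<le> y" "0 < \<delta>" "\<delta> \<le> 1"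
  shows "(x + y) powr \<delta> \<le> x powr \<delta> + y powr \<delta>"
proof (cases "x + y = 0")
  case False
  then have s: "0 < x + y" using assms by simp
  \<comment> \<open>An exponent at most 1 enlarges numbers in [0,1]; it is applied to the two
    fractions of x + y, which add up to 1.\<close>
  have "u \<le> u powr \<delta>" if "0 \<le> u" "u \<le> 1" for u :: real
    using powr_mono'[of \<delta> 1 u] that assms by simp
  then have "x / (x + y) \<le> (x / (x + y)) powr \<delta>" "y / (x + y) \<le> (y / (x + y)) powr \<delta>"
    using assms s by auto
  then have "x / (x + y) + y / (x + y) \<le> (x powr \<delta> + y powr \<delta>) / (x + y) powr \<delta>"
    using assms by (simp add: powr_divide add_divide_distrib)
  moreover have "x / (x + y) + y / (x + y) = 1"
    using s by (simp add: add_divide_distrib[symmetric])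
  ultimately show ?thesis
    using s by (simp add: le_divide_eq)
qed (use assms in auto)

text \<open>On each of three ranges of \<open>s\<close> the difference of the two sides increases
  with the absolute value of \<open>s\<close>, because its derivative reduces to an inequality
  between powers with exponent \<delta> - 1 in (0,1]. The constant 2 is used up in the range
  \<open>s \<le> -1\<close>, where 1 and (u - 1)^(\<delta> - 1) are each bounded by u^(\<delta> -
  1).\<close>

lemma powr_one_add_le:
  fixes s \<delta> :: real
  assumes \<delta>: "1 < \<delta>" "\<delta> \<le> 2"
  shows "\<bar>1 + s\<bar> powr \<delta> \<le> 1 + \<delta> * s + 2 * \<bar>s\<bar> powr \<delta>"
proof -
  \<comment> \<open>Some base reaches 0 at an end point of each interval below; continuity there
    rests on the positive exponent.\<close>
  have cont: "continuous_on S (\<lambda>u. (f u :: real) powr \<delta>)" if "continuous_on S f" "\<And>u. u \<in> S \<Longrightarrow> 0 \<le> f u" for S :: "real set" and f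
    using that \<delta> by (intro continuous_on_powr' continuous_on_const) auto
  consider "0 \<le> s" | "-1 \<le> s" "s \<le> 0" | "s \<le> -1" by linarith
  then show ?thesis
  proof cases
    case 1
    have "(\<lambda>u. 1 + \<delta> * u + 2 * u powr \<delta> - (1 + u) powr \<delta>) 0 \<le> (\<lambda>u. 1 + \<delta> * u + 2 * u powr \<delta> - (1 + u) powr \<delta>) s"
    proof (rule DERIV_nonneg_imp_increasing_open[OF 1])
      fix u :: real assume u: "0 < u" "u < s"
      have "(1 + u) powr (\<delta> - 1) \<le> 1 powr (\<delta> - 1) + u powr (\<delta> - 1)"
        using u \<delta> by (intro powr_add_le) auto
      then have "\<delta> * (1 + u) powr (\<delta> - 1) \<le> \<delta> * (1 + 2 * u powr (\<delta> - 1))"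
        using \<delta> by (intro mult_left_mono) (auto intro: order_trans)
      then have "0 \<le> \<delta> + 2 * (\<delta> * u powr (\<delta> - 1)) - \<delta> * (1 + u) powr (\<delta> - 1)"
        by (simp add: algebra_simps)
      moreover have "((\<lambda>u. 1 + \<delta> * u + 2 * u powr \<delta> - (1 + u) powr \<delta>) has_real_derivative
          \<delta> + 2 * (\<delta> * u powr (\<delta> - 1)) - \<delta> * (1 + u) powr (\<delta> - 1)) (at u)"
        using u by (auto intro!: derivative_eq_intros)
      ultimately show "\<exists>y. ((\<lambda>u. 1 + \<delta> * u + 2 * u powr \<delta> - (1 + u) powr \<delta>) has_real_derivative y) (at u) \<and> 0 \<le> y"
        by blast
    qed (use 1 in \<open>auto intro!: continuous_intros cont\<close>)
    then show ?thesis using 1 \<delta> by simp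
  next
    case 2
    define v where "v = - s"
    have v: "0 \<le> v" "v \<le> 1" using 2 by (auto simp: v_def)
    have "(\<lambda>u. 1 - \<delta> * u + 2 * u powr \<delta> - (1 - u) powr \<delta>) 0 \<le> (\<lambda>u. 1 - \<delta> * u + 2 * u powr \<delta> - (1 - u) powr \<delta>) v"
    proof (rule DERIV_nonneg_imp_increasing_open[OF v(1)])
      fix u :: real assume u: "0 < u" "u < v"
      have "u \<le> u powr (\<delta> - 1)" "1 - u \<le> (1 - u) powr (\<delta> - 1)"
        using powr_mono'[of "\<delta> - 1" 1 u] powr_mono'[of "\<delta> - 1" 1 "1 - u"] u v \<delta> by auto
      then have "\<delta> * 1 \<le> \<delta> * (2 * u powr (\<delta> - 1) + (1 - u) powr (\<delta> - 1))"
        using \<delta> u by (intro mult_left_mono) auto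
      then have "0 \<le> - \<delta> + 2 * (\<delta> * u powr (\<delta> - 1)) + \<delta> * (1 - u) powr (\<delta> - 1)"
        by (simp add: algebra_simps)
      moreover have "((\<lambda>u. 1 - \<delta> * u + 2 * u powr \<delta> - (1 - u) powr \<delta>) has_real_derivative
          - \<delta> + 2 * (\<delta> * u powr (\<delta> - 1)) + \<delta> * (1 - u) powr (\<delta> - 1)) (at u)"
        using u v by (auto intro!: derivative_eq_intros)
      ultimately show "\<exists>y. ((\<lambda>u. 1 - \<delta> * u + 2 * u powr \<delta> - (1 - u) powr \<delta>) has_real_derivative y) (at u) \<and> 0 \<le> y"
        by blast
    qed (use v in \<open>auto intro!: continuous_intros cont\<close>)
    then show ?thesis using v \<delta> by (simp add: v_def)
  next
    case 3
    define v where "v = - s"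
    have v: "1 \<le> v" using 3 by (auto simp: v_def)
    \<comment> \<open>This range starts at u = 1, where the difference equals 3 - \<delta> >
      0.\<close>
    have "(\<lambda>u. 1 - \<delta> * u + 2 * u powr \<delta> - (u - 1) powr \<delta>) 1 \<le> (\<lambda>u. 1 - \<delta> * u + 2 * u powr \<delta> - (u - 1) powr \<delta>) v"
    proof (rule DERIV_nonneg_imp_increasing_open[OF v])
      fix u :: real assume u: "1 < u" "u < v"
      have "(u - 1) powr (\<delta> - 1) \<le> u powr (\<delta> - 1)" "1 \<le> u powr (\<delta> - 1)"
        using u \<delta> by (auto intro!: powr_mono2 ge_one_powr_ge_zero)
      then have "\<delta> * (1 + (u - 1) powr (\<delta> - 1)) \<le> \<delta> * (2 * u powr (\<delta> - 1))"
        using \<delta> by (intro mult_left_mono) auto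
      then have "0 \<le> - \<delta> + 2 * (\<delta> * u powr (\<delta> - 1)) - \<delta> * (u - 1) powr (\<delta> - 1)"
        by (simp add: algebra_simps)
      moreover have "((\<lambda>u. 1 - \<delta> * u + 2 * u powr \<delta> - (u - 1) powr \<delta>) has_real_derivative
          - \<delta> + 2 * (\<delta> * u powr (\<delta> - 1)) - \<delta> * (u - 1) powr (\<delta> - 1)) (at u)"
        using u v by (auto intro!: derivative_eq_intros)
      ultimately show "\<exists>y. ((\<lambda>u. 1 - \<delta> * u + 2 * u powr \<delta> - (u - 1) powr \<delta>) has_real_derivative y) (at u) \<and> 0 \<le> y"
        by blast
    qed (use v in \<open>auto intro!: continuous_intros cont\<close>)
    moreover have "- s - 1 = - 1 - s" by simp
    ultimately show ?thesis using v \<delta> by (simp add: v_def)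
  qed
qed

text \<open>Homogeneity reduces this to x = 1. The middle term is \<open>y\<close> times the
  derivative of the power at \<open>x\<close>, hence it disappears on averaging over a centered
  \<open>y\<close>, and the coefficient of the first term stays 1.\<close>

lemma powr_abs_add_le:
  fixes x y \<delta> :: real
  assumes \<delta>: "1 < \<delta>" "\<delta> \<le> 2"
  shows "\<bar>x + y\<bar> powr \<delta> \<le> \<bar>x\<bar> powr \<delta> + \<delta> * sgn x * \<bar>x\<bar> powr (\<delta> - 1) * y + 2 * \<bar>y\<bar> powr \<delta>"
proof (cases "x = 0")
  case False
  define s where "s = y / x"
  have y: "y = x * s" using False by (simp add: s_def)
  have "\<bar>x + y\<bar> = \<bar>x\<bar> * \<bar>1 + s\<bar>"
    using y by (metis abs_mult distrib_left mult.right_neutral)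
  then have "\<bar>x + y\<bar> powr \<delta> = \<bar>x\<bar> powr \<delta> * \<bar>1 + s\<bar> powr \<delta>"
    by (simp add: powr_mult)
  also have "\<dots> \<le> \<bar>x\<bar> powr \<delta> * (1 + \<delta> * s + 2 * \<bar>s\<bar> powr \<delta>)"
    by (intro mult_left_mono powr_one_add_le \<delta>) simp
  also have "\<dots> = \<bar>x\<bar> powr \<delta> + \<delta> * (\<bar>x\<bar> powr \<delta> * s) + 2 * \<bar>y\<bar> powr \<delta>"
    by (simp add: y abs_mult powr_mult algebra_simps)
  also have "\<bar>x\<bar> powr \<delta> * s = sgn x * \<bar>x\<bar> powr (\<delta> - 1) * y"
  proof -
    have "\<bar>x\<bar> powr \<delta> = \<bar>x\<bar> powr (\<delta> - 1) * \<bar>x\<bar>"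
      using False powr_add[of "\<bar>x\<bar>" "\<delta> - 1" 1] by simp
    moreover have "\<bar>x\<bar> * s = sgn x * y"
      by (simp add: y abs_sgn mult_ac)
    ultimately show ?thesis by (simp add: mult_ac)
  qed
  finally show ?thesis by (simp add: mult_ac)
qed simp

text \<open>For \<delta> > 1 the only term that mixes \<open>z\<close> with \<open>D\<close> is
  linear in \<open>D\<close> and integrates to 0. What remains is additive in the two powers, as
  subadditivity gives it for \<delta> \<le> 1.\<close>

lemma (in prob_space) nn_integral_powr_add_le:
  assumes D [measurable]: "D \<in> borel_measurable M" and \<delta>: "0 < \<delta>" "\<delta> \<le> 2"
    and K: "(\<integral>\<^sup>+p. ennreal (\<bar>D p\<bar> powr \<delta>) \<partial>M) = ennreal K" "0 \<le> K"
    and centered: "1 < \<delta> \<Longrightarrow> integrable M D \<and> expectation D = 0"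
  shows "(\<integral>\<^sup>+p. ennreal (\<bar>z + D p\<bar> powr \<delta>) \<partial>M) \<le> ennreal (\<bar>z\<bar> powr \<delta> + (if \<delta> \<le> 1 then 1 else 2) * K)"
proof (cases "\<delta> \<le> 1")
  case True
  have "(\<integral>\<^sup>+p. ennreal (\<bar>z + D p\<bar> powr \<delta>) \<partial>M) \<le> (\<integral>\<^sup>+p. ennreal (\<bar>z\<bar> powr \<delta>) + ennreal (\<bar>D p\<bar> powr \<delta>) \<partial>M)"
  proof (intro nn_integral_mono)
    fix p
    have "\<bar>z + D p\<bar> powr \<delta> \<le> (\<bar>z\<bar> + \<bar>D p\<bar>) powr \<delta>"
      using \<delta> by (intro powr_mono2) auto
    also have "\<dots> \<le> \<bar>z\<bar> powr \<delta> + \<bar>D p\<bar> powr \<delta>"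
      using \<delta> True by (intro powr_add_le) auto
    finally show "ennreal (\<bar>z + D p\<bar> powr \<delta>) \<le> ennreal (\<bar>z\<bar> powr \<delta>) + ennreal (\<bar>D p\<bar> powr \<delta>)"
      by (simp add: ennreal_plus[symmetric] del: ennreal_plus)
  qed
  also have "\<dots> = ennreal (\<bar>z\<bar> powr \<delta> + K)"
    using K(2) by (subst nn_integral_add) (simp_all add: K(1) emeasure_space_1)
  finally show ?thesis using True by simp
next
  case False
  with centered have D: "integrable M D" "expectation D = 0" by auto
  have i: "integrable M (\<lambda>p. \<bar>D p\<bar> powr \<delta>)"
    by (rule integrableI_nonneg) (simp_all add: K)
  have iK: "expectation (\<lambda>p. \<bar>D p\<bar> powr \<delta>) = K"
    using K by (intro integral_eq_nn_integral[THEN trans]) (auto simp: enn2real_ennreal)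
  define g where "g p = \<bar>z\<bar> powr \<delta> + \<delta> * sgn z * \<bar>z\<bar> powr (\<delta> - 1) * D p + 2 * \<bar>D p\<bar> powr \<delta>" for p
  have le: "\<bar>z + D p\<bar> powr \<delta> \<le> g p" for p
    unfolding g_def using False \<delta> by (intro powr_abs_add_le) auto
  have ig: "integrable M g" unfolding g_def using D i by auto
  have "(\<integral>\<^sup>+p. ennreal (\<bar>z + D p\<bar> powr \<delta>) \<partial>M) \<le> (\<integral>\<^sup>+p. ennreal (g p) \<partial>M)"
    by (intro nn_integral_mono ennreal_leI le)
  also have "\<dots> = ennreal (expectation g)"
    by (rule nn_integral_eq_integral[OF ig]) (auto intro!: order_trans[OF _ le])
  also have "expectation g = \<bar>z\<bar> powr \<delta> + 2 * K"
    unfolding g_def using D i by (simp add: iK prob_space)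
  finally show ?thesis using False by simp
qed

section \<open>Sample spaces that split into independent subtrees\<close>

definition uniform01 :: "real measure" where
  "uniform01 = density lborel (indicator {0..1})"

lemma space_uniform01 [simp]: "space uniform01 = UNIV"
  and sets_uniform01 [simp, measurable_cong]: "sets uniform01 = sets borel"
  by (simp_all add: uniform01_def)

lemma prob_space_uniform01: "prob_space uniform01"
  by (rule prob_spaceI) (simp add: uniform01_def emeasure_density)

lemma AE_uniform01: "AE \<tau> in uniform01. 0 < \<tau> \<and> \<tau> \<le> 1"
proof -
  have "AE \<tau> in lborel. \<tau> \<noteq> (0::real)"
    by (rule AE_lborel_singleton)
  then show ?thesis
    unfolding uniform01_def
    by (subst AE_density) (auto elim!: eventually_mono split: split_indicator)
qed

lemma integral_uniform01:
  fixes f :: "real \<Rightarrow> 'c::{banach, second_countable_topology}"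
  assumes "f \<in> borel_measurable borel"
  shows "integral\<^sup>L uniform01 f = set_lebesgue_integral lborel {0..1} f"
proof -
  have *: "(indicator {0..1} :: real \<Rightarrow> ennreal) = (\<lambda>x. ennreal (indicator {0..1} x))"
    by (auto split: split_indicator)
  show ?thesis
    unfolding uniform01_def * set_lebesgue_integral_def
    using assms by (subst integral_density) auto
qed

lemma nn_integral_uniform01:
  assumes "f \<in> borel_measurable borel"
  shows "integral\<^sup>N uniform01 f = (\<integral>\<^sup>+\<tau>. f \<tau> * indicator {0..1} \<tau> \<partial>lborel)"
  unfolding uniform01_def
  using assms by (subst nn_integral_density) (auto simp: mult.commute)

text \<open>One sequence of node labels encodes a whole N-ary tree. Entry 0 is the root, and
  division with remainder by N deals the other entries out: entry \<open>Suc (N * k + i)\<close> is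
  the k-th label of the i-th subtree, which is encoded in the same way. \<open>glue_samples\<close>
  is the inverse operation.\<close>

definition sub_sample :: "nat \<Rightarrow> nat \<Rightarrow> (nat \<Rightarrow> 'c) \<Rightarrow> nat \<Rightarrow> 'c" where
  "sub_sample N i x = (\<lambda>k. x (Suc (N * k + i)))"

definition glue_samples :: "nat \<Rightarrow> 'c \<times> (nat \<Rightarrow> nat \<Rightarrow> 'c) \<Rightarrow> nat \<Rightarrow> 'c" where
  "glue_samples N p = (\<lambda>k. case k of 0 \<Rightarrow> fst p | Suc j \<Rightarrow> snd p (j mod N) (j div N))"

lemma glue_samples_0 [simp]: "glue_samples N (a, y) 0 = a"
  by (simp add: glue_samples_def)

lemma sub_glue_samples [simp]: "i < N \<Longrightarrow> sub_sample N i (glue_samples N (a, y)) = y i"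
  by (auto simp: sub_sample_def glue_samples_def)

lemma measurable_sub_sample [measurable]:
  "sub_sample N i \<in> PiM UNIV (\<lambda>_::nat. R) \<rightarrow>\<^sub>M PiM UNIV (\<lambda>_::nat. R)"
  unfolding sub_sample_def by (rule measurable_PiM_single') (auto simp: space_PiM)

lemma measurable_glue_samples [measurable]:
  assumes "0 < N"
  shows "glue_samples N \<in> R \<Otimes>\<^sub>M PiM {..<N} (\<lambda>_. PiM UNIV (\<lambda>_::nat. R)) \<rightarrow>\<^sub>M PiM UNIV (\<lambda>_::nat. R)"
proof (rule measurable_PiM_single')
  fix k :: nat
  show "(\<lambda>p. glue_samples N p k) \<in> R \<Otimes>\<^sub>M PiM {..<N} (\<lambda>_. PiM UNIV (\<lambda>_::nat. R)) \<rightarrow>\<^sub>M R"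
  proof (cases k)
    case (Suc j)
    have j: "j mod N \<in> {..<N}"
      using mod_less_divisor[OF assms, of j] by simp
    have "(\<lambda>p. snd p (j mod N)) \<in> R \<Otimes>\<^sub>M PiM {..<N} (\<lambda>_. PiM UNIV (\<lambda>_::nat. R)) \<rightarrow>\<^sub>M PiM UNIV (\<lambda>_::nat. R)"
      by (intro measurable_compose[OF measurable_snd] measurable_component_singleton j)
    from measurable_compose[OF this measurable_component_singleton[of "j div N"]]
    show ?thesis
      by (simp add: glue_samples_def Suc)
  qed (simp add: glue_samples_def)
qed (use assms in \<open>auto simp: glue_samples_def space_PiM space_pair_measure PiE_iff split: nat.splits\<close>)

text \<open>Regrouping the coordinates of an i.i.d. sequence leaves its law unchanged; this is the
  independence of the root and the N subtrees. It suffices to compare finite cylinders, whose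
  preimage is a product of a root event and N cylinders.\<close>

lemma distr_glue_samples:
  assumes N: "0 < N" and R: "prob_space R"
  shows "distr (R \<Otimes>\<^sub>M PiM {..<N} (\<lambda>_. PiM UNIV (\<lambda>_::nat. R))) (PiM UNIV (\<lambda>_::nat. R)) (glue_samples N)
     = PiM UNIV (\<lambda>_::nat. R)"
    (is "distr ?J ?S _ = _")
proof -
  interpret R: prob_space R by fact
  interpret S: prob_space ?S by (intro prob_space_PiM R)
  interpret SN: prob_space "PiM {..<N} (\<lambda>_. ?S)" by (intro prob_space_PiM S.prob_space_axioms)
  interpret PS: product_prob_space "\<lambda>_::nat. ?S" "{..<N}" by unfold_locales
  interpret J: pair_prob_space R "PiM {..<N} (\<lambda>_. ?S)" by unfold_locales
  note [measurable] = measurable_glue_samples[OF N]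
  show ?thesis
  proof (rule measure_eqI_PiM_infinite[symmetric, OF refl])
    fix A and F :: "nat set"
    assume F: "finite F" and A: "\<And>i. i \<in> F \<Longrightarrow> A i \<in> sets R"
    \<comment> \<open>Padding with the whole space turns a cylinder over F into a condition on every
      coordinate.\<close>
    define B where "B k = (if k \<in> F then A k else space R)" for k
    have B [measurable]: "B k \<in> sets R" for k
      using A by (auto simp: B_def)
    \<comment> \<open>No coordinate from \<open>m\<close> on is constrained. As
      \<open>m \<le> j div N\<close> forces \<open>m \<le> Suc j\<close>, keeping the first
      \<open>m\<close> entries of each subtree loses no constraint.\<close>
    define m where "m = Suc (Max (insert 0 F))"
    have m: "k < m" if "k \<in> F" for k
      unfolding m_def using F that by (simp add: less_Suc_eq_le)
    define E where "E i = prod_emb UNIV (\<lambda>_. R) {..<m} (\<Pi>\<^sub>E j\<in>{..<m}. B (Suc (N * j + i)))" for i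
    have E [measurable]: "E i \<in> sets ?S" for i
      unfolding E_def by (intro sets_PiM_I) auto
    have E_emb: "emeasure ?S (E i) = (\<Prod>j<m. emeasure R (B (Suc (N * j + i))))" for i
      unfolding E_def by (intro emeasure_PiM_emb R) auto
    have B_space: "x \<in> B k" if "m \<le> k" "x \<in> space R" for x k
      using m[of k] that by (auto simp: B_def)
    have bound: "m < Suc (m * N)" using N by (cases N) auto
    have eq: "prod_emb UNIV (\<lambda>_. R) F (Pi\<^sub>E F A) = {x\<in>space ?S. \<forall>k. x k \<in> B k}"
      by (auto simp: prod_emb_def space_PiM B_def PiE_iff split: if_splits)
    have pre: "glue_samples N -` {x\<in>space ?S. \<forall>k. x k \<in> B k} \<inter> space ?J = B 0 \<times> (\<Pi>\<^sub>E i\<in>{..<N}. E i)" (is "?L = ?P")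
    proof (intro set_eqI iffI)
      fix p assume p: "p \<in> ?L"
      obtain a y where ay: "p = (a, y)" by force
      have g: "glue_samples N (a, y) k \<in> B k" for k
        using p ay by auto
      have "y i j \<in> B (Suc (N * j + i))" if "i < N" for i j
        using g[of "Suc (N * j + i)"] that by (simp add: glue_samples_def)
      then show "p \<in> ?P"
        using p g[of 0] by (auto simp: ay E_def prod_emb_def space_pair_measure space_PiM PiE_iff)
    next
      fix p assume p: "p \<in> ?P"
      obtain a y where ay: "p = (a, y)" by force
      have a: "a \<in> B 0" and y: "y \<in> (\<Pi>\<^sub>E i\<in>{..<N}. E i)"
        using p ay by auto
      have sp: "p \<in> space ?J"
        using a y sets.sets_into_space[OF B[of 0]] 
        by (auto simp: ay space_pair_measure space_PiM E_def prod_emb_def PiE_iff)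
      have "glue_samples N (a, y) k \<in> B k" for k
      proof (cases k)
        case (Suc j)
        have yj: "y (j mod N) \<in> E (j mod N)" using y N by (auto simp: PiE_iff)
        show ?thesis
        proof (cases "j div N < m")
          case True
          moreover have "\<forall>l<m. y (j mod N) l \<in> B (Suc (N * l + j mod N))"
            using yj by (auto simp: E_def prod_emb_def PiE_iff)
          ultimately have "y (j mod N) (j div N) \<in> B (Suc (N * (j div N) + j mod N))"
            by blast
          then show ?thesis by (simp add: Suc glue_samples_def)
        next
          case False
          then have "m \<le> k"
            using Suc by (meson div_le_dividend le_SucI le_trans not_le)
          moreover have "y (j mod N) (j div N) \<in> space R"
            using yj by (auto simp: E_def prod_emb_def space_PiM)
          ultimately show ?thesis using B_space by (simp add: Suc glue_samples_def)
        qed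
      qed (simp add: a)
      then show "p \<in> ?L"
        using sp measurable_space[OF measurable_glue_samples[OF N] sp] by (auto simp: ay)
    qed
    have J_E: "emeasure ?J (B 0 \<times> (\<Pi>\<^sub>E i\<in>{..<N}. E i)) = emeasure R (B 0) * (\<Prod>i<N. emeasure ?S (E i))"
      by (subst SN.emeasure_pair_measure_Times) (auto simp: PS.emeasure_PiM intro!: sets_PiM_I_finite)
    have "emeasure (distr ?J ?S (glue_samples N)) {x\<in>space ?S. \<forall>k. x k \<in> B k} =
        emeasure R (B 0) * (\<Prod>i<N. \<Prod>j<m. emeasure R (B (Suc (N * j + i))))"
      by (subst emeasure_distr) (simp_all only: measurable_glue_samples[OF N] pre J_E E_emb, simp_all)
    also have "(\<Prod>i<N. \<Prod>j<m. emeasure R (B (Suc (N * j + i)))) = (\<Prod>j<m. \<Prod>i<N. emeasure R (B (Suc (N * j + i))))"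
      by (rule prod.swap)
    \<comment> \<open>For fixed j the indices N * j + i fill the j-th block of length N, so the
      double product meets every coordinate below m * N once.\<close>
    also have "\<dots> = (\<Prod>j<m. prod (\<lambda>k. emeasure R (B (Suc k))) {j * N..<j * N + N})"
    proof (rule prod.cong[OF refl])
      fix j
      show "(\<Prod>i<N. emeasure R (B (Suc (N * j + i)))) = prod (\<lambda>k. emeasure R (B (Suc k))) {j * N..<j * N + N}"
        by (rule prod.reindex_bij_witness[of _ "\<lambda>k. k - j * N" "\<lambda>i. N * j + i"])
          (auto simp: mult.commute)
    qed
    also have "\<dots> = (\<Prod>k<m * N. emeasure R (B (Suc k)))"
      by (rule prod.nat_group)
    also have "emeasure R (B 0) * \<dots> = (\<Prod>k<Suc (m * N). emeasure R (B k))"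
      by (subst prod.lessThan_Suc_shift) simp
    also have "\<dots> = (\<Prod>k\<in>F. emeasure R (A k))"
    proof (rule prod.mono_neutral_cong_right)
      show "F \<subseteq> {..<Suc (m * N)}"
      proof
        fix k assume "k \<in> F"
        then show "k \<in> {..<Suc (m * N)}"
          using m[of k] bound by (meson lessThan_iff less_trans)
      qed
    qed (auto simp: B_def R.emeasure_space_1)
    also have "\<dots> = emeasure ?S (prod_emb UNIV (\<lambda>_. R) F (Pi\<^sub>E F A))"
      using F A by (intro emeasure_PiM_emb[symmetric] R) auto
    finally show "emeasure ?S (prod_emb UNIV (\<lambda>_. R) F (Pi\<^sub>E F A)) =
      emeasure (distr ?J ?S (glue_samples N)) (prod_emb UNIV (\<lambda>_. R) F (Pi\<^sub>E F A))"
      by (simp add: eq)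
  qed (auto intro: S.finite_measure_axioms)
qed

text \<open>In the nonintegrable case the Bochner integral is 0, and \<open>B\<close> is nonnegative
  because a probability space has a point.\<close>

lemma (in prob_space) norm_integral_le_const:
  fixes f :: "'a \<Rightarrow> 'c::{banach, second_countable_topology}"
  assumes "\<And>x. x \<in> space M \<Longrightarrow> norm (f x) \<le> B"
  shows "norm (\<integral>x. f x \<partial>M) \<le> B"
proof (cases "integrable M f")
  case True
  then have "(\<integral>x. norm (f x) \<partial>M) \<le> (\<integral>x. B \<partial>M)"
    using assms by (intro integral_mono) auto
  then show ?thesis
    by (intro order_trans[OF integral_norm_bound]) (simp add: prob_space)
next
  case False
  obtain x where "x \<in> space M" using not_empty by auto
  from order_trans[OF norm_ge_zero assms[OF this]] show ?thesis
    by (simp add: not_integrable_integral_eq[OF False])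
qed

lemma integral_pair_bounded:
  fixes f :: "_ \<Rightarrow> 'c::{banach, second_countable_topology}"
  assumes "prob_space M1" "prob_space M2" and [measurable]: "f \<in> borel_measurable (M1 \<Otimes>\<^sub>M M2)"
    and B: "\<And>x. norm (f x) \<le> B"
  shows "integral\<^sup>L (M1 \<Otimes>\<^sub>M M2) f = (\<integral>x. \<integral>y. f (x, y) \<partial>M2 \<partial>M1)"
proof -
  interpret M1: prob_space M1 by fact
  interpret M2: prob_space M2 by fact
  interpret pair_prob_space M1 M2 ..
  show ?thesis
    by (rule integral_fst'[symmetric]) (auto intro!: integrable_const_bound[of _ B] simp: B)
qed

section \<open>Random trees\<close>

text \<open>Each node carries a splitting label \<open>\<tau>\<close>, a sample of the weights and a
  leaf sample; \<open>\<tau>\<close> decides which of the last two is read.\<close>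

definition node_measure :: "'a measure \<Rightarrow> 'b measure \<Rightarrow> (real \<times> 'a \<times> 'b) measure" where
  "node_measure M P = uniform01 \<Otimes>\<^sub>M (M \<Otimes>\<^sub>M P)"

text \<open>Trees are cut at depth \<open>n\<close>, the removed subtrees contributing 0; \<open>tree_complete\<close> says that
  nothing has been cut.\<close>

primrec tree_value ::
  "nat \<Rightarrow> (nat \<Rightarrow> 'a \<Rightarrow> real) \<Rightarrow> ('b \<Rightarrow> real) \<Rightarrow> nat \<Rightarrow> (nat \<Rightarrow> real \<times> 'a \<times> 'b) \<Rightarrow> real \<Rightarrow> real" where
  "tree_value N A h 0 x r = 0"
| "tree_value N A h (Suc n) x r = (case x 0 of (\<tau>, \<omega>, p) \<Rightarrow>
     if \<tau> < r then h p else \<Sum>i<N. A i \<omega> * tree_value N A h n (sub_sample N i x) (r / \<tau>))"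

primrec tree_complete :: "nat \<Rightarrow> nat \<Rightarrow> (nat \<Rightarrow> real \<times> 'c) \<Rightarrow> real \<Rightarrow> bool" where
  "tree_complete N 0 x r = False"
| "tree_complete N (Suc n) x r =
     (fst (x 0) < r \<or> (\<forall>i<N. tree_complete N n (sub_sample N i x) (r / fst (x 0))))"

lemma tree_complete_value:
  "tree_complete N n x r \<Longrightarrow> tree_value N A h (n + k) x r = tree_value N A h n x r"
proof (induction n arbitrary: x r)
  case (Suc n)
  then show ?case
    by (cases "x 0") (auto intro!: sum.cong)
qed simp

text \<open>Tree sums are linear in the leaf function. Hence the difference of the sums of X and Y
  over one tree is again a tree sum, with leaf values X - Y.\<close>

lemma tree_value_diff:
  "tree_value N A f n x r - tree_value N A g n x r = tree_value N A (\<lambda>p. f p - g p) n x r"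
  by (induction n arbitrary: x r)
    (simp_all add: case_prod_beta flip: sum_subtractf right_diff_distrib)

text \<open>\<open>P\<close> is the space of leaf samples. In the final proof it is a coupling of
  the two initial laws, read through \<open>fst\<close> and \<open>snd\<close>, so that both leaf
  values sit on one tree.\<close>

locale random_tree =
  fixes M :: "'a measure" and N :: nat and A :: "nat \<Rightarrow> 'a \<Rightarrow> real" and P :: "'b measure"
  assumes prob_M: "prob_space M" and prob_P: "prob_space P" and N_pos: "0 < N"
    and A_meas: "i < N \<Longrightarrow> A i \<in> borel_measurable M"
begin

abbreviation "node \<equiv> node_measure M P"
abbreviation "samples \<equiv> PiM UNIV (\<lambda>_::nat. node)"
abbreviation "children \<equiv> PiM {..<N} (\<lambda>_. samples)"

sublocale M: prob_space M by (fact prob_M)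
sublocale P: prob_space P by (fact prob_P)
sublocale U: prob_space uniform01 by (fact prob_space_uniform01)
sublocale MP: pair_prob_space M P ..
sublocale UMP: pair_prob_space uniform01 "M \<Otimes>\<^sub>M P" ..
sublocale node: prob_space node unfolding node_measure_def by (fact UMP.prob_space_axioms)
sublocale samples: prob_space samples by (intro prob_space_PiM node.prob_space_axioms)
sublocale children: prob_space children by (intro prob_space_PiM samples.prob_space_axioms)
sublocale NS: pair_prob_space node children ..
sublocale children_prod: product_prob_space "\<lambda>_::nat. samples" "{..<N}" ..

lemma sets_node [measurable_cong]: "sets node = sets (borel \<Otimes>\<^sub>M (M \<Otimes>\<^sub>M P))"
  unfolding node_measure_def by (intro sets_pair_measure_cong) auto

lemma measurable_tree_value [measurable]:
  assumes h [measurable]: "h \<in> borel_measurable P"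
  shows "(\<lambda>(x, r). tree_value N A h n x r) \<in> borel_measurable (samples \<Otimes>\<^sub>M borel)"
proof (induction n)
  case (Suc n)
  note Suc[measurable]
  have x0 [measurable]: "(\<lambda>q. fst q 0) \<in> samples \<Otimes>\<^sub>M borel \<rightarrow>\<^sub>M node"
    by (intro measurable_compose[OF measurable_fst] measurable_component_singleton) simp
  have sub [measurable]: "(\<lambda>q. sub_sample N i (fst q)) \<in> samples \<Otimes>\<^sub>M (borel :: real measure) \<rightarrow>\<^sub>M samples" for i
    by measurable
  have t [measurable]: "(\<lambda>q. fst (fst q 0)) \<in> borel_measurable (samples \<Otimes>\<^sub>M borel)"
    and p [measurable]: "(\<lambda>q. snd (snd (fst q 0))) \<in> samples \<Otimes>\<^sub>M borel \<rightarrow>\<^sub>M P"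
    and w [measurable]: "(\<lambda>q. fst (snd (fst q 0))) \<in> samples \<Otimes>\<^sub>M borel \<rightarrow>\<^sub>M M"
    using x0 by measurable
  have A: "(\<lambda>q. A i (fst (snd (fst q 0)))) \<in> borel_measurable (samples \<Otimes>\<^sub>M borel)" if "i < N" for i
    by (rule measurable_compose[OF w A_meas[OF that]])
  have Z: "(\<lambda>q. tree_value N A h n (sub_sample N i (fst q)) (snd q / fst (fst q 0))) \<in> borel_measurable (samples \<Otimes>\<^sub>M borel)" for i
  proof -
    have "(\<lambda>q. (sub_sample N i (fst q), snd q / fst (fst q 0))) \<in> samples \<Otimes>\<^sub>M borel \<rightarrow>\<^sub>M samples \<Otimes>\<^sub>M borel"
      by measurable
    from measurable_compose[OF this Suc] show ?thesis by simp
  qed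
  have [measurable]: "(\<lambda>q. \<Sum>i<N. A i (fst (snd (fst q 0))) * tree_value N A h n (sub_sample N i (fst q)) (snd q / fst (fst q 0)))
    \<in> borel_measurable (samples \<Otimes>\<^sub>M borel)"
    by (intro borel_measurable_sum borel_measurable_times A Z) auto
  have "(\<lambda>q. if fst (fst q 0) < snd q then h (snd (snd (fst q 0))) else
      \<Sum>i<N. A i (fst (snd (fst q 0))) * tree_value N A h n (sub_sample N i (fst q)) (snd q / fst (fst q 0)))
    \<in> borel_measurable (samples \<Otimes>\<^sub>M borel)"
    by measurable
  then show ?case
    by (simp add: case_prod_beta')
qed simp

lemma measurable_tree_value' [measurable (raw)]:
  assumes "h \<in> borel_measurable P" and f: "f \<in> K \<rightarrow>\<^sub>M samples" and g: "g \<in> borel_measurable K"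
  shows "(\<lambda>q. tree_value N A h n (f q) (g q)) \<in> borel_measurable K"
  using measurable_compose[OF measurable_Pair[OF f g] measurable_tree_value[OF assms(1)]] by simp

lemma measurable_tree_complete [measurable]:
  "Measurable.pred (samples \<Otimes>\<^sub>M borel) (\<lambda>(x, r). tree_complete N n x r)"
proof (induction n)
  case (Suc n)
  have x0 [measurable]: "(\<lambda>q. fst q 0) \<in> samples \<Otimes>\<^sub>M borel \<rightarrow>\<^sub>M node"
    by (intro measurable_compose[OF measurable_fst] measurable_component_singleton) simp
  have t [measurable]: "(\<lambda>q. fst (fst q 0)) \<in> borel_measurable (samples \<Otimes>\<^sub>M borel)"
    using x0 by measurable
  have Z [measurable]: "Measurable.pred (samples \<Otimes>\<^sub>M borel) (\<lambda>q. tree_complete N n (sub_sample N i (fst q)) (snd q / fst (fst q 0)))" for i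
  proof -
    have "(\<lambda>q. (sub_sample N i (fst q), snd q / fst (fst q 0))) \<in> samples \<Otimes>\<^sub>M borel \<rightarrow>\<^sub>M samples \<Otimes>\<^sub>M borel"
      by measurable
    from measurable_compose[OF this Suc] show ?thesis by simp
  qed
  have "Measurable.pred (samples \<Otimes>\<^sub>M borel) (\<lambda>q. fst (fst q 0) < snd q \<or>
      (\<forall>i\<in>{..<N}. tree_complete N n (sub_sample N i (fst q)) (snd q / fst (fst q 0))))"
    by measurable
  then show ?case
    by (simp add: case_prod_beta' lessThan_iff)
qed simp

lemma measurable_tree_complete' [measurable (raw)]:
  assumes f: "f \<in> K \<rightarrow>\<^sub>M samples" and g: "g \<in> borel_measurable K"
  shows "Measurable.pred K (\<lambda>q. tree_complete N n (f q) (g q))"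
  using measurable_compose[OF measurable_Pair[OF f g] measurable_tree_complete] by simp

lemma nn_integral_samples:
  assumes [measurable]: "f \<in> borel_measurable samples"
  shows "(\<integral>\<^sup>+x. f x \<partial>samples) = (\<integral>\<^sup>+\<tau>. \<integral>\<^sup>+\<omega>. \<integral>\<^sup>+p. \<integral>\<^sup>+y. f (glue_samples N ((\<tau>, \<omega>, p), y)) \<partial>children \<partial>P \<partial>M \<partial>uniform01)"
proof -
  note [measurable] = measurable_glue_samples[OF N_pos]
  have "(\<integral>\<^sup>+x. f x \<partial>samples) = (\<integral>\<^sup>+q. f (glue_samples N q) \<partial>(node \<Otimes>\<^sub>M children))"
    by (subst distr_glue_samples[OF N_pos node.prob_space_axioms, symmetric], subst nn_integral_distr) auto
  also have "\<dots> = (\<integral>\<^sup>+a. \<integral>\<^sup>+y. f (glue_samples N (a, y)) \<partial>children \<partial>node)"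
    by (rule children.nn_integral_fst[symmetric]) measurable
  also have "\<dots> = (\<integral>\<^sup>+\<tau>. \<integral>\<^sup>+z. \<integral>\<^sup>+y. f (glue_samples N ((\<tau>, z), y)) \<partial>children \<partial>(M \<Otimes>\<^sub>M P) \<partial>uniform01)"
    unfolding node_measure_def
    by (rule MP.nn_integral_fst[symmetric])
      (unfold node_measure_def[symmetric], measurable)
  also have "\<dots> = (\<integral>\<^sup>+\<tau>. \<integral>\<^sup>+\<omega>. \<integral>\<^sup>+p. \<integral>\<^sup>+y. f (glue_samples N ((\<tau>, \<omega>, p), y)) \<partial>children \<partial>P \<partial>M \<partial>uniform01)"
    by (intro nn_integral_cong P.nn_integral_fst[symmetric]) measurable
  finally show ?thesis .
qed

lemma integral_samples:
  fixes f :: "_ \<Rightarrow> 'c::{banach, second_countable_topology}"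
  assumes [measurable]: "f \<in> borel_measurable samples" and B: "\<And>x. norm (f x) \<le> B"
  shows "(\<integral>x. f x \<partial>samples) = (\<integral>\<tau>. \<integral>\<omega>. \<integral>p. \<integral>y. f (glue_samples N ((\<tau>, \<omega>, p), y)) \<partial>children \<partial>P \<partial>M \<partial>uniform01)"
proof -
  note [measurable] = measurable_glue_samples[OF N_pos]
  have bound: "norm (\<integral>y. f (glue_samples N (a, y)) \<partial>children) \<le> B" for a
    by (rule children.norm_integral_le_const[OF B])
  have "(\<integral>x. f x \<partial>samples) = (\<integral>q. f (glue_samples N q) \<partial>(node \<Otimes>\<^sub>M children))"
    by (subst distr_glue_samples[OF N_pos node.prob_space_axioms, symmetric], subst integral_distr) auto
  also have "\<dots> = (\<integral>a. \<integral>y. f (glue_samples N (a, y)) \<partial>children \<partial>node)"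
    by (rule integral_pair_bounded[OF node.prob_space_axioms children.prob_space_axioms _ B]) measurable
  also have "\<dots> = (\<integral>\<tau>. \<integral>z. \<integral>y. f (glue_samples N ((\<tau>, z), y)) \<partial>children \<partial>(M \<Otimes>\<^sub>M P) \<partial>uniform01)"
    unfolding node_measure_def
    by (rule integral_pair_bounded[OF prob_space_uniform01 MP.prob_space_axioms, of _ B])
      (unfold node_measure_def[symmetric], measurable, rule bound)
  also have "\<dots> = (\<integral>\<tau>. \<integral>\<omega>. \<integral>p. \<integral>y. f (glue_samples N ((\<tau>, \<omega>, p), y)) \<partial>children \<partial>P \<partial>M \<partial>uniform01)"
    by (intro Bochner_Integration.integral_cong refl integral_pair_bounded[OF prob_M prob_P, of _ B] bound) measurable
  finally show ?thesis .
qed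

end

section \<open>Integrals of products of independent factors and integrals over the uniform
  law\<close>

lemma integral_iid_prod:
  fixes f :: "nat \<Rightarrow> 'c \<Rightarrow> complex"
  assumes "prob_space S" and f: "\<And>i. i < N \<Longrightarrow> f i \<in> borel_measurable S"
    and B: "\<And>i z. i < N \<Longrightarrow> norm (f i z) \<le> 1"
  shows "(\<integral>y. (\<Prod>i<N. f i (y i)) \<partial>PiM {..<N} (\<lambda>_. S)) = (\<Prod>i<N. \<integral>z. f i z \<partial>S)"
proof -
  interpret S: prob_space S by fact
  interpret product_prob_space "\<lambda>_::nat. S" "{..<N}" ..
  show ?thesis
    by (rule product_integral_prod) (auto intro!: S.integrable_const_bound[of _ 1] f B)
qed

text \<open>\<open>G\<close> is controlled on \<open>{r..1}\<close> only: in the application it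
  involves the solution at time -ln (r / \<open>\<tau>\<close>), which is nonnegative exactly when
  \<open>\<tau>\<close> \<ge> r.\<close>

lemma integral_uniform01_split:
  fixes G :: "real \<Rightarrow> 'c::{banach, second_countable_topology}"
  assumes r: "0 < r" "r \<le> 1" and [measurable]: "(\<lambda>\<tau>. indicator {r..1} \<tau> *\<^sub>R G \<tau>) \<in> borel_measurable borel"
    and B: "\<And>\<tau>. r \<le> \<tau> \<Longrightarrow> \<tau> \<le> 1 \<Longrightarrow> norm (G \<tau>) \<le> B"
  shows "integrable uniform01 (\<lambda>\<tau>. if \<tau> < r then c else indicator {r..1} \<tau> *\<^sub>R G \<tau>)"
    and "(\<integral>\<tau>. (if \<tau> < r then c else indicator {r..1} \<tau> *\<^sub>R G \<tau>) \<partial>uniform01)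
      = r *\<^sub>R c + set_lebesgue_integral lborel {r..1} G"
proof -
  interpret prob_space uniform01 by (rule prob_space_uniform01)
  have "0 \<le> B" using order_trans[OF norm_ge_zero B[of 1]] r by auto
  then have B': "norm (indicator {r..1} \<tau> *\<^sub>R G \<tau>) \<le> B" for \<tau>
    using B by (auto split: split_indicator)
  show "integrable uniform01 (\<lambda>\<tau>. if \<tau> < r then c else indicator {r..1} \<tau> *\<^sub>R G \<tau>)"
    by (rule integrable_const_bound[of _ "max B (norm c)"]) (use B' in \<open>auto simp: le_max_iff_disj\<close>)
  have i1: "integrable lborel (\<lambda>\<tau>. indicator {0..<r} \<tau> *\<^sub>R c)"
    using r by (intro integrable_indicator) auto
  have i2: "integrable lborel (\<lambda>\<tau>. indicator {r..1} \<tau> *\<^sub>R G \<tau>)"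
    by (rule integrableI_bounded_set[where A="{r..1}" and B=B])
      (use B r in \<open>auto intro!: AE_I2 split: split_indicator\<close>)
  have "(\<integral>\<tau>. (if \<tau> < r then c else indicator {r..1} \<tau> *\<^sub>R G \<tau>) \<partial>uniform01)
    = (\<integral>\<tau>. indicator {0..<r} \<tau> *\<^sub>R c + indicator {r..1} \<tau> *\<^sub>R G \<tau> \<partial>lborel)"
    by (subst integral_uniform01)
      (use r in \<open>auto simp: set_lebesgue_integral_def intro!: Bochner_Integration.integral_cong split: split_indicator\<close>)
  also have "\<dots> = r *\<^sub>R c + set_lebesgue_integral lborel {r..1} G"
    using i1 i2 r by (simp add: set_lebesgue_integral_def)
  finally show "(\<integral>\<tau>. (if \<tau> < r then c else indicator {r..1} \<tau> *\<^sub>R G \<tau>) \<partial>uniform01)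
      = r *\<^sub>R c + set_lebesgue_integral lborel {r..1} G" .
qed

text \<open>The measure lives on all of \<open>real\<close>; the absolute value keeps the bounding
  function nonnegative off [0,1] as well.\<close>

lemma integral_uniform01_power:
  "integrable uniform01 (\<lambda>\<tau>. c * \<bar>\<tau>\<bar> ^ k)" "(\<integral>\<tau>. c * \<bar>\<tau>\<bar> ^ k \<partial>uniform01) = c / Suc k"
proof -
  interpret prob_space uniform01 by (rule prob_space_uniform01)
  show "integrable uniform01 (\<lambda>\<tau>. c * \<bar>\<tau>\<bar> ^ k)"
    by (rule integrable_const_bound[of _ "\<bar>c\<bar>"])
      (auto intro!: eventually_mono[OF AE_uniform01] simp: abs_mult power_le_one mult_left_le)
  have "(\<integral>\<tau>. c * \<bar>\<tau>\<bar> ^ k \<partial>uniform01) = (\<integral>\<tau>. c * (\<tau> ^ k * indicator {0..1} \<tau>) \<partial>lborel)"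
    by (subst integral_uniform01)
      (auto simp: set_lebesgue_integral_def intro!: Bochner_Integration.integral_cong split: split_indicator)
  also have "\<dots> = c / Suc k"
    by (simp add: integral_power)
  finally show "(\<integral>\<tau>. c * \<bar>\<tau>\<bar> ^ k \<partial>uniform01) = c / Suc k" .
qed

section \<open>Characteristic functions of cut trees\<close>

context random_tree
begin

lemma tree_value_glue:
  "tree_value N A h (Suc n) (glue_samples N ((\<tau>, \<omega>, p), y)) r =
    (if \<tau> < r then h p else \<Sum>i<N. A i \<omega> * tree_value N A h n (y i) (r / \<tau>))"
  by (auto intro!: sum.cong)

definition tree_char :: "('b \<Rightarrow> real) \<Rightarrow> nat \<Rightarrow> real \<Rightarrow> real \<Rightarrow> complex" where
  "tree_char h n r \<xi> = (\<integral>x. iexp (\<xi> * tree_value N A h n x r) \<partial>samples)"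

lemma norm_tree_char_le: "norm (tree_char h n r \<xi>) \<le> 1"
  unfolding tree_char_def by (rule samples.norm_integral_le_const) simp

lemma measurable_tree_char [measurable]:
  assumes [measurable]: "h \<in> borel_measurable P" "f \<in> borel_measurable K" "g \<in> borel_measurable K"
  shows "(\<lambda>q. tree_char h n (f q) (g q)) \<in> borel_measurable K"
  unfolding tree_char_def by measurable

text \<open>Conditioning on the root: given its label, the subtrees are independent copies, so the
  exponential of the weighted sum integrates to a product.\<close>

lemma tree_char_Suc:
  assumes [measurable]: "h \<in> borel_measurable P"
  shows "tree_char h (Suc n) r \<xi> = (\<integral>\<tau>. (if \<tau> < r then (\<integral>p. iexp (\<xi> * h p) \<partial>P)
      else (\<integral>\<omega>. (\<Prod>i<N. tree_char h n (r / \<tau>) (A i \<omega> * \<xi>)) \<partial>M)) \<partial>uniform01)"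
proof -
  have prod: "(\<integral>y. iexp (\<xi> * (\<Sum>i<N. A i \<omega> * tree_value N A h n (y i) s)) \<partial>children)
     = (\<Prod>i<N. tree_char h n s (A i \<omega> * \<xi>))" for \<omega> s
  proof -
    have "(\<integral>y. iexp (\<xi> * (\<Sum>i<N. A i \<omega> * tree_value N A h n (y i) s)) \<partial>children)
      = (\<integral>y. (\<Prod>i<N. iexp (A i \<omega> * \<xi> * tree_value N A h n (y i) s)) \<partial>children)"
      by (intro Bochner_Integration.integral_cong refl)
        (simp add: sum_distrib_left exp_sum mult_ac)
    also have "\<dots> = (\<Prod>i<N. tree_char h n s (A i \<omega> * \<xi>))"
      unfolding tree_char_def by (rule integral_iid_prod[OF samples.prob_space_axioms]) (simp_all, measurable)
    finally show ?thesis .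
  qed
  have "tree_char h (Suc n) r \<xi> = (\<integral>\<tau>. \<integral>\<omega>. \<integral>p. \<integral>y. iexp (\<xi> * tree_value N A h (Suc n)
      (glue_samples N ((\<tau>, \<omega>, p), y)) r) \<partial>children \<partial>P \<partial>M \<partial>uniform01)"
    unfolding tree_char_def by (rule integral_samples[of _ 1]) (simp_all del: tree_value.simps)
  also have "\<dots> = (\<integral>\<tau>. (if \<tau> < r then (\<integral>p. iexp (\<xi> * h p) \<partial>P)
      else (\<integral>\<omega>. (\<Prod>i<N. tree_char h n (r / \<tau>) (A i \<omega> * \<xi>)) \<partial>M)) \<partial>uniform01)"
    by (intro Bochner_Integration.integral_cong refl)
      (simp add: tree_value_glue prod children.prob_space P.prob_space M.prob_space
        del: tree_value.simps of_real_mult of_real_sum)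
  finally show ?thesis .
qed

text \<open>With the weight \<open>(1 / r) ^ (2 * N)\<close> one step of the recursion contracts by \<open>N / (2 * N + 1) < 1 / 2\<close>.\<close>

lemma tree_char_error:
  assumes h [measurable]: "h \<in> borel_measurable P"
    and w: "\<And>r \<xi>. 0 < r \<Longrightarrow> r \<le> 1 \<Longrightarrow> norm (w r \<xi>) \<le> 1"
    and w_meas: "\<And>r \<xi>. 0 < r \<Longrightarrow> r \<le> 1 \<Longrightarrow> (\<lambda>\<omega>. \<Prod>i<N. w r (A i \<omega> * \<xi>)) \<in> borel_measurable M"
    and w_int: "\<And>r \<xi>. 0 < r \<Longrightarrow> r \<le> 1 \<Longrightarrow>
      (\<lambda>\<tau>. indicator {r..1} \<tau> *\<^sub>R (\<integral>\<omega>. (\<Prod>i<N. w (r / \<tau>) (A i \<omega> * \<xi>)) \<partial>M)) \<in> borel_measurable borel"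
    and w_eq: "\<And>r \<xi>. 0 < r \<Longrightarrow> r \<le> 1 \<Longrightarrow> w r \<xi> = r *\<^sub>R (\<integral>p. iexp (\<xi> * h p) \<partial>P) +
      set_lebesgue_integral lborel {r..1} (\<lambda>\<tau>. \<integral>\<omega>. (\<Prod>i<N. w (r / \<tau>) (A i \<omega> * \<xi>)) \<partial>M)"
  shows "0 < r \<Longrightarrow> r \<le> 1 \<Longrightarrow> norm (tree_char h n r \<xi> - w r \<xi>) \<le> 2 * (1/2) ^ n * (1 / r) ^ (2 * N)"
proof (induction n arbitrary: r \<xi>)
  case 0
  have "norm (tree_char h 0 r \<xi> - w r \<xi>) \<le> 1 + 1"
    by (intro order_trans[OF norm_triangle_ineq4] add_mono norm_tree_char_le w 0)
  moreover have "1 \<le> (1 / r) ^ (2 * N)"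
    using 0 by (intro one_le_power) simp
  ultimately show ?case by simp
next
  case (Suc n)
  define c where "c = (\<integral>p. iexp (\<xi> * h p) \<partial>P)"
  define G where "G \<tau> = (\<integral>\<omega>. (\<Prod>i<N. w (r / \<tau>) (A i \<omega> * \<xi>)) \<partial>M)" for \<tau>
  define T where "T \<tau> = (\<integral>\<omega>. (\<Prod>i<N. tree_char h n (r / \<tau>) (A i \<omega> * \<xi>)) \<partial>M)" for \<tau>
  have A' [measurable]: "\<And>i. i \<in> {..<N} \<Longrightarrow> A i \<in> borel_measurable M" using A_meas by simp
  have T_meas: "T \<in> borel_measurable borel"
    unfolding T_def by measurable
  have prod_le: "norm (\<Prod>i<N. tree_char h n s (A i \<omega> * \<xi>)) \<le> 1" for s \<omega>
    unfolding prod_norm[symmetric] by (intro prod_le_1) (auto simp: norm_tree_char_le)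
  have prod_le': "norm (\<Prod>i<N. w (r / \<tau>) (A i \<omega> * \<xi>)) \<le> 1" if "r \<le> \<tau>" "\<tau> \<le> 1" for \<tau> \<omega>
    unfolding prod_norm[symmetric] using Suc.prems that by (intro prod_le_1) (auto intro!: w)
  note T_split = integral_uniform01_split[of r T 1 c]
  note G_split = integral_uniform01_split[of r G 1 c]
  have T1: "norm (T \<tau>) \<le> 1" for \<tau>
    unfolding T_def by (rule M.norm_integral_le_const[OF prod_le])
  have G1: "norm (G \<tau>) \<le> 1" if "r \<le> \<tau>" "\<tau> \<le> 1" for \<tau>
    unfolding G_def by (rule M.norm_integral_le_const[OF prod_le'[OF that]])
  have G_meas: "(\<lambda>\<tau>. indicator {r..1} \<tau> *\<^sub>R G \<tau>) \<in> borel_measurable borel"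
    unfolding G_def by (rule w_int[OF Suc.prems])
  have T_meas': "(\<lambda>\<tau>. indicator {r..1} \<tau> *\<^sub>R T \<tau>) \<in> borel_measurable borel"
    using T_meas by measurable
  \<comment> \<open>As \<open>\<tau>\<close> \<le> 1 almost surely, cutting \<open>T\<close> off
    outside [r,1] changes nothing, and it matches the form in which \<open>G\<close> is
    available.\<close>
  have tc: "tree_char h (Suc n) r \<xi> = (\<integral>\<tau>. (if \<tau> < r then c else indicator {r..1} \<tau> *\<^sub>R T \<tau>) \<partial>uniform01)"
    unfolding tree_char_Suc[OF h] c_def[symmetric] T_def[symmetric]
    using T_meas by (intro integral_cong_AE eventually_mono[OF AE_uniform01]) auto
  have w_c: "w r \<xi> = (\<integral>\<tau>. (if \<tau> < r then c else indicator {r..1} \<tau> *\<^sub>R G \<tau>) \<partial>uniform01)"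
    using G_split(2)[OF Suc.prems G_meas G1] w_eq[OF Suc.prems, of \<xi>] unfolding c_def G_def by simp
  define B where "B = N * (2 * (1/2) ^ n) * (1 / r) ^ (2 * N)"
  have diff: "norm (T \<tau> - G \<tau>) \<le> B * \<bar>\<tau>\<bar> ^ (2 * N)" if \<tau>: "r \<le> \<tau>" "\<tau> \<le> 1" for \<tau>
  proof -
    have r': "0 < r / \<tau>" "r / \<tau> \<le> 1" using \<tau> Suc.prems by auto
    have "T \<tau> - G \<tau> = (\<integral>\<omega>. (\<Prod>i<N. tree_char h n (r / \<tau>) (A i \<omega> * \<xi>)) - (\<Prod>i<N. w (r / \<tau>) (A i \<omega> * \<xi>)) \<partial>M)"
      unfolding T_def G_def
      by (intro Bochner_Integration.integral_diff[symmetric] M.integrable_const_bound[of _ 1])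
        (auto intro!: prod_le prod_le'[OF \<tau>] w_meas[OF r'])
    also have "norm \<dots> \<le> B * \<bar>\<tau>\<bar> ^ (2 * N)"
    proof (rule M.norm_integral_le_const)
      fix \<omega>
      \<comment> \<open>All factors have norm at most 1, so the error of the product is at most the
        sum of the N errors; this is the factor N in \<open>B\<close>.\<close>
      have "norm ((\<Prod>i<N. tree_char h n (r / \<tau>) (A i \<omega> * \<xi>)) - (\<Prod>i<N. w (r / \<tau>) (A i \<omega> * \<xi>)))
        \<le> (\<Sum>i<N. norm (tree_char h n (r / \<tau>) (A i \<omega> * \<xi>) - w (r / \<tau>) (A i \<omega> * \<xi>)))"
        by (intro norm_prod_diff norm_tree_char_le w r')
      also have "\<dots> \<le> (\<Sum>i<N. 2 * (1/2) ^ n * (1 / (r / \<tau>)) ^ (2 * N))"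
        by (intro sum_mono Suc.IH r')
      also have "\<dots> = B * \<bar>\<tau>\<bar> ^ (2 * N)"
        using \<tau> Suc.prems by (simp add: B_def power_divide)
      finally show "norm ((\<Prod>i<N. tree_char h n (r / \<tau>) (A i \<omega> * \<xi>)) - (\<Prod>i<N. w (r / \<tau>) (A i \<omega> * \<xi>))) \<le> B * \<bar>\<tau>\<bar> ^ (2 * N)" .
    qed
    finally show ?thesis .
  qed
  have B0: "0 \<le> B" using Suc.prems by (simp add: B_def)
  have "tree_char h (Suc n) r \<xi> - w r \<xi> =
     (\<integral>\<tau>. (if \<tau> < r then c else indicator {r..1} \<tau> *\<^sub>R T \<tau>) - (if \<tau> < r then c else indicator {r..1} \<tau> *\<^sub>R G \<tau>) \<partial>uniform01)"
    unfolding tc w_c using T_split(1)[OF Suc.prems T_meas' T1] G_split(1)[OF Suc.prems G_meas G1]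
    by (intro Bochner_Integration.integral_diff[symmetric])
  also have "norm \<dots> \<le> (\<integral>\<tau>. B * \<bar>\<tau>\<bar> ^ (2 * N) \<partial>uniform01)"
    by (intro Bochner_Integration.integral_norm_bound_integral Bochner_Integration.integrable_diff T_split(1)[OF Suc.prems T_meas' T1]
        G_split(1)[OF Suc.prems G_meas G1] integral_uniform01_power(1))
      (use B0 diff in \<open>auto split: split_indicator\<close>)
  also have "\<dots> = B / Suc (2 * N)"
    by (rule integral_uniform01_power(2))
  also have "\<dots> \<le> B / (2 * N)"
    using B0 N_pos by (intro divide_left_mono) auto
  also have "\<dots> = 2 * (1/2) ^ Suc n * (1 / r) ^ (2 * N)"
    using N_pos by (simp add: B_def)
  finally show ?case .
qed

section \<open>Almost every tree is finite, and the value of the uncut tree\<close>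

lemma nn_integral_children_component:
  assumes "i < N" "f \<in> borel_measurable samples"
  shows "(\<integral>\<^sup>+y. f (y i) \<partial>children) = (\<integral>\<^sup>+x. f x \<partial>samples)"
proof -
  have "distr children samples (\<lambda>y. y i) = samples"
    using assms(1) by (intro distr_PiM_component samples.prob_space_axioms) auto
  then have "(\<integral>\<^sup>+x. f x \<partial>samples) = (\<integral>\<^sup>+x. f x \<partial>distr children samples (\<lambda>y. y i))"
    by simp
  also have "\<dots> = (\<integral>\<^sup>+y. f (y i) \<partial>children)"
    using assms by (intro nn_integral_distr) auto
  finally show ?thesis ..
qed

text \<open>A tree is cut if one of its N subtrees is, so a union bound costs a factor N, while
  integrating \<open>\<tau>\<close> to the power 2 * N gains 1 / (2 * N + 1). The weight of
  \<open>tree_char_error\<close> thus halves the probability at every level.\<close>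

lemma tree_incomplete_le:
  "0 < r \<Longrightarrow> r \<le> 1 \<Longrightarrow>
    (\<integral>\<^sup>+x. of_bool (\<not> tree_complete N n x r) \<partial>samples) \<le> ennreal ((1/2) ^ n * (1 / r) ^ (2 * N))"
proof (induction n arbitrary: r)
  case 0
  have "1 \<le> (1 / r) ^ (2 * N)"
    using 0 by (intro one_le_power) simp
  then show ?case by (simp add: samples.emeasure_space_1)
next
  case (Suc n)
  define B where "B = N * (1/2) ^ n * (1 / r) ^ (2 * N)"
  have B0: "0 \<le> B" using Suc.prems by (simp add: B_def)
  have "(\<integral>\<^sup>+x. of_bool (\<not> tree_complete N (Suc n) x r) \<partial>samples) =
     (\<integral>\<^sup>+\<tau>. \<integral>\<^sup>+\<omega>. \<integral>\<^sup>+p. \<integral>\<^sup>+y. of_bool (\<not> tree_complete N (Suc n) (glue_samples N ((\<tau>, \<omega>, p), y)) r)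
       \<partial>children \<partial>P \<partial>M \<partial>uniform01)"
    by (rule nn_integral_samples) measurable
  also have "\<dots> \<le> (\<integral>\<^sup>+\<tau>. ennreal (B * \<bar>\<tau>\<bar> ^ (2 * N)) \<partial>uniform01)"
  proof (intro nn_integral_mono_AE eventually_mono[OF AE_uniform01])
    fix \<tau> :: real assume \<tau>: "0 < \<tau> \<and> \<tau> \<le> 1"
    have "(\<integral>\<^sup>+y. of_bool (\<not> tree_complete N (Suc n) (glue_samples N ((\<tau>, \<omega>, p), y)) r) \<partial>children)
      \<le> ennreal (B * \<bar>\<tau>\<bar> ^ (2 * N))" (is "?I \<le> _") for \<omega> p
    proof (cases "\<tau> < r")
      case True
      then show ?thesis by simp
    next
      case False
      with \<tau> Suc.prems have r': "0 < r / \<tau>" "r / \<tau> \<le> 1" by auto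
      have "?I \<le> (\<integral>\<^sup>+y. (\<Sum>i<N. of_bool (\<not> tree_complete N n (y i) (r / \<tau>))) \<partial>children)"
      proof (intro nn_integral_mono)
        fix y
        show "of_bool (\<not> tree_complete N (Suc n) (glue_samples N ((\<tau>, \<omega>, p), y)) r)
          \<le> (\<Sum>i<N. of_bool (\<not> tree_complete N n (y i) (r / \<tau>)) :: ennreal)"
        proof (cases "\<forall>i<N. tree_complete N n (y i) (r / \<tau>)")
          case False
          then obtain i where i: "i < N" "\<not> tree_complete N n (y i) (r / \<tau>)" by auto
          have "(1 :: ennreal) = of_bool (\<not> tree_complete N n (y i) (r / \<tau>))" using i by simp
          also have "\<dots> \<le> (\<Sum>i<N. of_bool (\<not> tree_complete N n (y i) (r / \<tau>)))"
            using i by (intro member_le_sum) auto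
          finally show ?thesis by (auto simp: of_bool_def)
        qed simp
      qed
      also have "\<dots> = (\<Sum>i<N. \<integral>\<^sup>+y. of_bool (\<not> tree_complete N n (y i) (r / \<tau>)) \<partial>children)"
        by (intro nn_integral_sum) measurable
      also have "\<dots> = (\<Sum>i<N. \<integral>\<^sup>+x. of_bool (\<not> tree_complete N n x (r / \<tau>)) \<partial>samples)"
        by (intro sum.cong refl nn_integral_children_component) (simp, measurable)
      also have "\<dots> \<le> (\<Sum>i<N. ennreal ((1/2) ^ n * (1 / (r / \<tau>)) ^ (2 * N)))"
        by (intro sum_mono Suc.IH r')
      also have "\<dots> = ennreal (B * \<bar>\<tau>\<bar> ^ (2 * N))"
        using Suc.prems \<tau> by (subst sum_ennreal) (simp_all add: B_def power_divide)
      finally show ?thesis .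
    qed
    then have "(\<integral>\<^sup>+\<omega>. \<integral>\<^sup>+p. \<integral>\<^sup>+y. of_bool (\<not> tree_complete N (Suc n) (glue_samples N ((\<tau>, \<omega>, p), y)) r)
       \<partial>children \<partial>P \<partial>M) \<le> (\<integral>\<^sup>+\<omega>. \<integral>\<^sup>+p. ennreal (B * \<bar>\<tau>\<bar> ^ (2 * N)) \<partial>P \<partial>M)"
      by (intro nn_integral_mono)
    then show "(\<integral>\<^sup>+\<omega>. \<integral>\<^sup>+p. \<integral>\<^sup>+y. of_bool (\<not> tree_complete N (Suc n) (glue_samples N ((\<tau>, \<omega>, p), y)) r)
       \<partial>children \<partial>P \<partial>M) \<le> ennreal (B * \<bar>\<tau>\<bar> ^ (2 * N))"
      by (simp add: M.emeasure_space_1 P.emeasure_space_1)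
  qed
  also have "\<dots> = ennreal (\<integral>\<tau>. B * \<bar>\<tau>\<bar> ^ (2 * N) \<partial>uniform01)"
    using B0 by (intro nn_integral_eq_integral integral_uniform01_power) auto
  also have "\<dots> \<le> ennreal (B / (2 * N))"
    unfolding integral_uniform01_power using B0 N_pos by (intro ennreal_leI divide_left_mono) auto
  also have "B / (2 * N) = (1/2) ^ Suc n * (1 / r) ^ (2 * N)"
    using N_pos by (simp add: B_def)
  finally show ?case .
qed

lemma AE_tree_complete:
  assumes r: "0 < r" "r \<le> 1"
  shows "AE x in samples. \<exists>n. tree_complete N n x r"
proof -
  have "(\<integral>\<^sup>+x. of_bool (\<forall>n. \<not> tree_complete N n x r) \<partial>samples) \<le> 0"
  proof (rule LIMSEQ_le_const)
    have "(\<lambda>n. (1/2) ^ n * (1 / r) ^ (2 * N)) \<longlonglongrightarrow> 0 * (1 / r) ^ (2 * N)"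
      by (intro tendsto_intros LIMSEQ_realpow_zero) auto
    then show "(\<lambda>n. ennreal ((1/2) ^ n * (1 / r) ^ (2 * N))) \<longlonglongrightarrow> 0"
      using tendsto_ennrealI by fastforce
    have "(\<integral>\<^sup>+x. of_bool (\<forall>n. \<not> tree_complete N n x r) \<partial>samples) \<le> ennreal ((1/2) ^ n * (1 / r) ^ (2 * N))" for n
      by (rule order_trans[OF nn_integral_mono tree_incomplete_le[OF r]]) (auto simp: of_bool_def)
    then show "\<exists>n0. \<forall>n\<ge>n0. (\<integral>\<^sup>+x. of_bool (\<forall>n. \<not> tree_complete N n x r) \<partial>samples) \<le> ennreal ((1/2) ^ n * (1 / r) ^ (2 * N))"
      by blast
  qed
  moreover have "(\<lambda>x. of_bool (\<forall>n. \<not> tree_complete N n x r) :: ennreal) \<in> borel_measurable samples"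
    by measurable
  ultimately have "AE x in samples. (of_bool (\<forall>n. \<not> tree_complete N n x r) :: ennreal) = 0"
    by (subst nn_integral_0_iff_AE[symmetric]) auto
  then show ?thesis by eventually_elim auto
qed

text \<open>On almost every sample the sequence is eventually constant and this is the value of the
  uncut tree; the arbitrary value of \<open>lim\<close> elsewhere affects a null set only.\<close>

definition tree_limit :: "('b \<Rightarrow> real) \<Rightarrow> real \<Rightarrow> (nat \<Rightarrow> real \<times> 'a \<times> 'b) \<Rightarrow> real" where
  "tree_limit h r x = lim (\<lambda>n. tree_value N A h n x r)"

lemma measurable_tree_limit [measurable]:
  assumes [measurable]: "h \<in> borel_measurable P"
  shows "tree_limit h r \<in> borel_measurable samples"
  unfolding tree_limit_def by measurable

text \<open>Completeness depends on the splitting labels alone. One null set therefore serves all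
  leaf functions, which is why the quantifier over \<open>h\<close> stands inside.\<close>

lemma AE_tree_limit:
  assumes r: "0 < r" "r \<le> 1"
  shows "AE x in samples. \<forall>h. (\<lambda>n. tree_value N A h n x r) \<longlonglongrightarrow> tree_limit h r x"
  using AE_tree_complete[OF r]
proof eventually_elim
  case (elim x)
  then obtain n where n: "tree_complete N n x r" by auto
  show ?case
  proof
    fix h
    have "(\<lambda>m. tree_value N A h m x r) \<longlonglongrightarrow> tree_value N A h n x r"
    proof (rule tendsto_eventually)
      show "\<forall>\<^sub>F m in sequentially. tree_value N A h m x r = tree_value N A h n x r"
        using tree_complete_value[OF n] by (auto simp: eventually_sequentially le_iff_add intro!: exI[of _ n])
    qed
    then show "(\<lambda>n. tree_value N A h n x r) \<longlonglongrightarrow> tree_limit h r x"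
      unfolding tree_limit_def by (simp add: limI)
  qed
qed

text \<open>The characteristic functions of the cut trees converge to that of the limit by bounded
  convergence and to \<open>w\<close> by \<open>tree_char_error\<close>. So any solution
  \<open>w\<close> bounded by 1 is identified as the characteristic function of the tree
  sum.\<close>

lemma char_tree_limit:
  assumes h [measurable]: "h \<in> borel_measurable P" and r: "0 < r" "r \<le> 1"
    and w: "\<And>r \<xi>. 0 < r \<Longrightarrow> r \<le> 1 \<Longrightarrow> norm (w r \<xi>) \<le> 1"
    and w_meas: "\<And>r \<xi>. 0 < r \<Longrightarrow> r \<le> 1 \<Longrightarrow> (\<lambda>\<omega>. \<Prod>i<N. w r (A i \<omega> * \<xi>)) \<in> borel_measurable M"
    and w_int: "\<And>r \<xi>. 0 < r \<Longrightarrow> r \<le> 1 \<Longrightarrow>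
      (\<lambda>\<tau>. indicator {r..1} \<tau> *\<^sub>R (\<integral>\<omega>. (\<Prod>i<N. w (r / \<tau>) (A i \<omega> * \<xi>)) \<partial>M)) \<in> borel_measurable borel"
    and w_eq: "\<And>r \<xi>. 0 < r \<Longrightarrow> r \<le> 1 \<Longrightarrow> w r \<xi> = r *\<^sub>R (\<integral>p. iexp (\<xi> * h p) \<partial>P) +
      set_lebesgue_integral lborel {r..1} (\<lambda>\<tau>. \<integral>\<omega>. (\<Prod>i<N. w (r / \<tau>) (A i \<omega> * \<xi>)) \<partial>M)"
  shows "char (distr samples borel (tree_limit h r)) = w r"
proof
  fix \<xi>
  have "(\<lambda>n. tree_char h n r \<xi>) \<longlonglongrightarrow> (\<integral>x. iexp (\<xi> * tree_limit h r x) \<partial>samples)"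
    unfolding tree_char_def
  proof (rule integral_dominated_convergence[where w="\<lambda>_. 1"])
    show "AE x in samples. (\<lambda>n. iexp (\<xi> * tree_value N A h n x r)) \<longlonglongrightarrow> iexp (\<xi> * tree_limit h r x)"
      using AE_tree_limit[OF r] by eventually_elim (auto intro!: tendsto_intros)
  qed auto
  moreover have "(\<lambda>n. tree_char h n r \<xi>) \<longlonglongrightarrow> w r \<xi>"
  proof (rule Lim_transform2[OF tendsto_const])
    show "(\<lambda>n. w r \<xi> - tree_char h n r \<xi>) \<longlonglongrightarrow> 0"
    proof (rule Lim_null_comparison)
      show "\<forall>\<^sub>F n in sequentially. norm (w r \<xi> - tree_char h n r \<xi>) \<le> 2 * (1/2) ^ n * (1 / r) ^ (2 * N)"
        using tree_char_error[OF h w w_meas w_int w_eq r] by (simp add: norm_minus_commute)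
      have "(\<lambda>n. 2 * (1/2) ^ n * (1 / r) ^ (2 * N)) \<longlonglongrightarrow> 2 * 0 * (1 / r) ^ (2 * N)"
        by (intro tendsto_intros LIMSEQ_realpow_zero) auto
      then show "(\<lambda>n. 2 * (1/2) ^ n * (1 / r) ^ (2 * N)) \<longlonglongrightarrow> 0" by simp
    qed
  qed
  ultimately show "char (distr samples borel (tree_limit h r)) \<xi> = w r \<xi>"
    unfolding char_def by (subst integral_distr) (auto intro: LIMSEQ_unique)
qed

section \<open>Moments of tree sums\<close>

lemma nn_integral_powr_scaled:
  assumes \<delta>: "0 < \<delta>" and a: "0 \<le> a"
    and S [measurable]: "S \<in> borel_measurable samples"
    and K: "\<And>z. (\<integral>\<^sup>+x. ennreal (\<bar>z + S x\<bar> powr \<delta>) \<partial>samples) \<le> ennreal (\<bar>z\<bar> powr \<delta> + K)"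
    and K0: "0 \<le> K"
  shows "(\<integral>\<^sup>+x. ennreal (\<bar>z + a * S x\<bar> powr \<delta>) \<partial>samples) \<le> ennreal (\<bar>z\<bar> powr \<delta> + a powr \<delta> * K)"
proof (cases "a = 0")
  case True
  then show ?thesis by (simp add: samples.emeasure_space_1)
next
  case False
  with a have a: "0 < a" by simp
  have "\<bar>z + a * s\<bar> powr \<delta> = a powr \<delta> * \<bar>z / a + s\<bar> powr \<delta>" for s
  proof -
    have "z + a * s = a * (z / a + s)" using a by (simp add: field_simps)
    then show ?thesis using a by (simp add: abs_mult powr_mult)
  qed
  then have "(\<integral>\<^sup>+x. ennreal (\<bar>z + a * S x\<bar> powr \<delta>) \<partial>samples)
    = ennreal (a powr \<delta>) * (\<integral>\<^sup>+x. ennreal (\<bar>z / a + S x\<bar> powr \<delta>) \<partial>samples)"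
    by (simp add: ennreal_mult' nn_integral_cmult)
  \<comment> \<open>The assumption holds at every offset, hence at z / a.\<close>
  also have "\<dots> \<le> ennreal (a powr \<delta>) * ennreal (\<bar>z / a\<bar> powr \<delta> + K)"
    by (intro mult_left_mono K) simp
  also have "\<dots> = ennreal (\<bar>z\<bar> powr \<delta> + a powr \<delta> * K)"
    using a K0 by (subst ennreal_mult'[symmetric]) (simp_all add: distrib_left powr_divide)
  finally show ?thesis .
qed

text \<open>Quantifying over the offset \<open>z\<close> is what lets a bound for one summand be iterated over
  independent summands without multiplying constants.\<close>

lemma nn_integral_powr_sum:
  fixes k :: nat
  assumes \<delta>: "0 < \<delta>" and a: "\<And>i. i < k \<Longrightarrow> 0 \<le> a i"
    and S [measurable]: "S \<in> borel_measurable samples"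
    and K: "\<And>z. (\<integral>\<^sup>+x. ennreal (\<bar>z + S x\<bar> powr \<delta>) \<partial>samples) \<le> ennreal (\<bar>z\<bar> powr \<delta> + K)"
    and K0: "0 \<le> K"
  shows "(\<integral>\<^sup>+y. ennreal (\<bar>z + (\<Sum>i<k. a i * S (y i))\<bar> powr \<delta>) \<partial>PiM {..<k} (\<lambda>_. samples))
    \<le> ennreal (\<bar>z\<bar> powr \<delta> + (\<Sum>i<k. a i powr \<delta>) * K)"
  using a
proof (induction k)
  case 0
  show ?case by (simp add: PiM_empty nn_integral_count_space_finite)
next
  case (Suc k)
  interpret F: prob_space "PiM {..<k} (\<lambda>_. samples)"
    by (intro prob_space_PiM samples.prob_space_axioms)
  have S': "(\<lambda>y. S (y i)) \<in> borel_measurable (PiM I (\<lambda>_. samples))" if "i \<in> I" for i and I :: "nat set"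
    using that by (intro measurable_compose[OF _ S]) simp
  have [measurable]: "(\<lambda>y. \<Sum>i<k. a i * S (y i)) \<in> borel_measurable (PiM {..<k} (\<lambda>_. samples))"
    by (intro borel_measurable_sum borel_measurable_times S') auto
  have [measurable]: "(\<lambda>y. \<Sum>i<Suc k. a i * S (y i)) \<in> borel_measurable (PiM (insert k {..<k}) (\<lambda>_. samples))"
    by (intro borel_measurable_sum borel_measurable_times S') auto
  have "(\<integral>\<^sup>+y. ennreal (\<bar>z + (\<Sum>i<Suc k. a i * S (y i))\<bar> powr \<delta>) \<partial>PiM {..<Suc k} (\<lambda>_. samples))
    = (\<integral>\<^sup>+y. (\<integral>\<^sup>+x. ennreal (\<bar>z + (\<Sum>i<Suc k. a i * S ((y(k := x)) i))\<bar> powr \<delta>) \<partial>samples) \<partial>PiM {..<k} (\<lambda>_. samples))"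
    unfolding lessThan_Suc by (subst children_prod.product_nn_integral_insert) (auto simp: lessThan_Suc[symmetric])
  \<comment> \<open>With the first k summands fixed, their sum joins the offset and the last summand
    is integrated alone.\<close>
  also have "\<dots> = (\<integral>\<^sup>+y. (\<integral>\<^sup>+x. ennreal (\<bar>(z + (\<Sum>i<k. a i * S (y i))) + a k * S x\<bar> powr \<delta>) \<partial>samples) \<partial>PiM {..<k} (\<lambda>_. samples))"
    by (simp add: add.assoc)
  also have "\<dots> \<le> (\<integral>\<^sup>+y. ennreal (\<bar>z + (\<Sum>i<k. a i * S (y i))\<bar> powr \<delta> + a k powr \<delta> * K) \<partial>PiM {..<k} (\<lambda>_. samples))"
    using Suc.prems by (intro nn_integral_mono nn_integral_powr_scaled \<delta> S K K0) auto
  also have "\<dots> = (\<integral>\<^sup>+y. ennreal (\<bar>z + (\<Sum>i<k. a i * S (y i))\<bar> powr \<delta>) \<partial>PiM {..<k} (\<lambda>_. samples)) + ennreal (a k powr \<delta> * K)"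
    using K0 by (simp add: nn_integral_add F.emeasure_space_1)
  also have "\<dots> \<le> ennreal (\<bar>z\<bar> powr \<delta> + (\<Sum>i<k. a i powr \<delta>) * K) + ennreal (a k powr \<delta> * K)"
    using Suc by (intro add_right_mono Suc.IH) auto
  also have "\<dots> = ennreal (\<bar>z\<bar> powr \<delta> + (\<Sum>i<Suc k. a i powr \<delta>) * K)"
    using K0 by (subst ennreal_plus[symmetric]) (auto simp: distrib_right add.assoc intro!: sum_nonneg mult_nonneg_nonneg add_nonneg_nonneg)
  finally show ?case .
qed

text \<open>The function m(r) = K * r^(1 - q) is the exact solution of m(r) = r * K + q * (integral
  of m(r / \<tau>) over \<tau> in [r,1]), where q is the mean of the sum of A_i^\<delta>. So one
  step of the recursion reproduces the bound with no loss, uniformly in the depth. At r = exp (-t)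
  the power is exp ((q - 1) * t).\<close>

lemma tree_value_moment:
  assumes h [measurable]: "h \<in> borel_measurable P" and \<delta>: "0 < \<delta>"
    and A_nonneg: "\<And>i \<omega>. i < N \<Longrightarrow> \<omega> \<in> space M \<Longrightarrow> 0 \<le> A i \<omega>"
    and q: "(\<integral>\<^sup>+\<omega>. (\<Sum>i<N. ennreal (A i \<omega> powr \<delta>)) \<partial>M) = ennreal q" "0 \<le> q"
    and K: "\<And>z. (\<integral>\<^sup>+p. ennreal (\<bar>z + h p\<bar> powr \<delta>) \<partial>P) \<le> ennreal (\<bar>z\<bar> powr \<delta> + K)" "0 \<le> K"
  shows "0 < r \<Longrightarrow> r \<le> 1 \<Longrightarrow> (\<integral>\<^sup>+x. ennreal (\<bar>z + tree_value N A h n x r\<bar> powr \<delta>) \<partial>samples)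
    \<le> ennreal (\<bar>z\<bar> powr \<delta> + K * r powr (1 - q))"
proof (induction n arbitrary: r z)
  case 0
  then show ?case using K by (simp add: samples.emeasure_space_1)
next
  case (Suc n)
  have A' [measurable]: "\<And>i. i \<in> {..<N} \<Longrightarrow> A i \<in> borel_measurable M" using A_meas by simp
  define Z where "Z = \<bar>z\<bar> powr \<delta>"
  have Z0: "0 \<le> Z" by (simp add: Z_def)
  \<comment> \<open>The second term is q times the bound claimed at \<open>r / \<tau>\<close>, with
    the powers of r and \<open>\<tau>\<close> separated.\<close>
  define g where "g \<tau> = Z + q * K * r powr (1 - q) * \<tau> powr (q - 1)" for \<tau>
  have g_meas [measurable]: "g \<in> borel_measurable borel"
    unfolding g_def by measurable
  have "(\<integral>\<^sup>+x. ennreal (\<bar>z + tree_value N A h (Suc n) x r\<bar> powr \<delta>) \<partial>samples) =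
     (\<integral>\<^sup>+\<tau>. \<integral>\<^sup>+\<omega>. \<integral>\<^sup>+p. \<integral>\<^sup>+y. ennreal (\<bar>z + tree_value N A h (Suc n) (glue_samples N ((\<tau>, \<omega>, p), y)) r\<bar> powr \<delta>)
       \<partial>children \<partial>P \<partial>M \<partial>uniform01)"
    by (rule nn_integral_samples) measurable
  also have "\<dots> \<le> (\<integral>\<^sup>+\<tau>. ennreal (if \<tau> < r then Z + K else g \<tau>) \<partial>uniform01)"
  proof (intro nn_integral_mono_AE eventually_mono[OF AE_uniform01])
    fix \<tau> :: real assume \<tau>: "0 < \<tau> \<and> \<tau> \<le> 1"
    show "(\<integral>\<^sup>+\<omega>. \<integral>\<^sup>+p. \<integral>\<^sup>+y. ennreal (\<bar>z + tree_value N A h (Suc n) (glue_samples N ((\<tau>, \<omega>, p), y)) r\<bar> powr \<delta>)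
       \<partial>children \<partial>P \<partial>M) \<le> ennreal (if \<tau> < r then Z + K else g \<tau>)"
    proof (cases "\<tau> < r")
      case True
      then show ?thesis
        using K(1)[of z] by (simp add: tree_value_glue children.emeasure_space_1 M.emeasure_space_1 Z_def del: tree_value.simps)
    next
      case False
      with \<tau> Suc.prems have r': "0 < r / \<tau>" "r / \<tau> \<le> 1" by auto
      define L where "L = K * (r / \<tau>) powr (1 - q)"
      have L0: "0 \<le> L" using K by (simp add: L_def)
      have "(\<integral>\<^sup>+\<omega>. \<integral>\<^sup>+p. \<integral>\<^sup>+y. ennreal (\<bar>z + tree_value N A h (Suc n) (glue_samples N ((\<tau>, \<omega>, p), y)) r\<bar> powr \<delta>)
          \<partial>children \<partial>P \<partial>M) = (\<integral>\<^sup>+\<omega>. \<integral>\<^sup>+y. ennreal (\<bar>z + (\<Sum>i<N. A i \<omega> * tree_value N A h n (y i) (r / \<tau>))\<bar> powr \<delta>)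
          \<partial>children \<partial>M)"
        using False by (simp add: tree_value_glue P.emeasure_space_1 del: tree_value.simps)
      also have "\<dots> \<le> (\<integral>\<^sup>+\<omega>. ennreal (Z + (\<Sum>i<N. A i \<omega> powr \<delta>) * L) \<partial>M)"
        unfolding Z_def
        by (intro nn_integral_mono nn_integral_powr_sum \<delta> A_nonneg L0) (simp_all add: L_def Suc.IH r')
      also have "\<dots> = (\<integral>\<^sup>+\<omega>. ennreal Z + (\<Sum>i<N. ennreal (A i \<omega> powr \<delta>)) * ennreal L \<partial>M)"
        using Z0 L0 by (intro nn_integral_cong)
          (simp add: ennreal_plus ennreal_mult sum_nonneg)
      also have "\<dots> = ennreal Z + ennreal q * ennreal L"
        by (subst nn_integral_add) (simp_all add: nn_integral_multc q M.emeasure_space_1 del: sum_ennreal)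
      also have "\<dots> = ennreal (Z + q * L)"
        using Z0 L0 q by (simp add: ennreal_plus ennreal_mult)
      also have "Z + q * L = g \<tau>"
        using \<tau> Suc.prems by (simp add: g_def L_def powr_divide powr_diff field_simps)
      finally show ?thesis using False by simp
    qed
  qed
  also have "\<dots> = (\<integral>\<^sup>+\<tau>. ennreal (Z + K) * indicator {0..<r} \<tau> + ennreal (g \<tau>) * indicator {r..1} \<tau> \<partial>lborel)"
    using Suc.prems by (subst nn_integral_uniform01)
      (auto intro!: nn_integral_cong split: split_indicator)
  also have "\<dots> = ennreal (Z + K) * ennreal r + (\<integral>\<^sup>+\<tau>. ennreal (g \<tau>) * indicator {r..1} \<tau> \<partial>lborel)"
    using Suc.prems by (subst nn_integral_add) (auto simp: nn_integral_cmult)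
  \<comment> \<open>The factor q of \<open>g\<close> is the one produced by differentiating
    \<open>\<tau> powr q\<close>, so no division by q occurs and q = 0 is covered.\<close>
  also have "(\<integral>\<^sup>+\<tau>. ennreal (g \<tau>) * indicator {r..1} \<tau> \<partial>lborel) =
      ennreal ((Z * 1 + K * r powr (1 - q) * 1 powr q) - (Z * r + K * r powr (1 - q) * r powr q))"
  proof (rule nn_integral_FTC_Icc)
    fix \<tau> assume \<tau>: "\<tau> \<in> {r..1}"
    show "DERIV (\<lambda>\<tau>. Z * \<tau> + K * r powr (1 - q) * \<tau> powr q) \<tau> :> g \<tau>"
      using \<tau> Suc.prems by (auto intro!: derivative_eq_intros simp: g_def)
    show "0 \<le> g \<tau>" using Z0 q K by (simp add: g_def)
  qed (use Suc.prems in auto)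
  also have "ennreal (Z + K) * ennreal r + ennreal ((Z * 1 + K * r powr (1 - q) * 1 powr q) - (Z * r + K * r powr (1 - q) * r powr q))
      = ennreal ((Z + K) * r + ((Z * 1 + K * r powr (1 - q) * 1 powr q) - (Z * r + K * r powr (1 - q) * r powr q)))"
  proof -
    have "Z * r \<le> Z" "K * r powr (1 - q) * r powr q \<le> K * r powr (1 - q)"
      using Suc.prems Z0 K q by (auto intro!: mult_left_le powr_le1)
    then show ?thesis
      using Z0 K Suc.prems by (subst ennreal_mult'[symmetric], simp, subst ennreal_plus[symmetric]) auto
  qed
  also have "(Z + K) * r + ((Z * 1 + K * r powr (1 - q) * 1 powr q) - (Z * r + K * r powr (1 - q) * r powr q)) = Z + K * r powr (1 - q)"
  proof -
    have "r powr (1 - q) * r powr q = r" using Suc.prems by (simp flip: powr_add)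
    then show ?thesis by (simp add: algebra_simps)
  qed
  finally show ?case by (simp add: Z_def)
qed

text \<open>The moment bound is uniform in the depth, so Fatou carries it, at offset 0, to the uncut
  tree.\<close>

lemma tree_limit_moment:
  assumes X [measurable]: "X \<in> borel_measurable P" and Y [measurable]: "Y \<in> borel_measurable P"
    and r: "0 < r" "r \<le> 1" and \<delta>: "0 < \<delta>"
    and A_nonneg: "\<And>i \<omega>. i < N \<Longrightarrow> \<omega> \<in> space M \<Longrightarrow> 0 \<le> A i \<omega>"
    and q: "(\<integral>\<^sup>+\<omega>. (\<Sum>i<N. ennreal (A i \<omega> powr \<delta>)) \<partial>M) = ennreal q" "0 \<le> q"
    and K: "\<And>z. (\<integral>\<^sup>+p. ennreal (\<bar>z + (X p - Y p)\<bar> powr \<delta>) \<partial>P) \<le> ennreal (\<bar>z\<bar> powr \<delta> + K)" "0 \<le> K"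
  shows "(\<integral>\<^sup>+x. ennreal (\<bar>tree_limit X r x - tree_limit Y r x\<bar> powr \<delta>) \<partial>samples) \<le> ennreal (K * r powr (1 - q))"
proof -
  have "(\<integral>\<^sup>+x. ennreal (\<bar>tree_limit X r x - tree_limit Y r x\<bar> powr \<delta>) \<partial>samples)
    = (\<integral>\<^sup>+x. liminf (\<lambda>n. ennreal (\<bar>tree_value N A X n x r - tree_value N A Y n x r\<bar> powr \<delta>)) \<partial>samples)"
  proof (rule nn_integral_cong_AE, use AE_tree_limit[OF r] in eventually_elim)
    case (elim x)
    have "(\<lambda>n. ennreal (\<bar>tree_value N A X n x r - tree_value N A Y n x r\<bar> powr \<delta>))
      \<longlonglongrightarrow> ennreal (\<bar>tree_limit X r x - tree_limit Y r x\<bar> powr \<delta>)"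
      using elim \<delta> by (intro tendsto_ennrealI tendsto_powr' tendsto_rabs tendsto_diff tendsto_const) auto
    from lim_imp_Liminf[OF _ this] show ?case by simp
  qed
  also have "\<dots> \<le> liminf (\<lambda>n. \<integral>\<^sup>+x. ennreal (\<bar>tree_value N A X n x r - tree_value N A Y n x r\<bar> powr \<delta>) \<partial>samples)"
    by (rule nn_integral_liminf) measurable
  also have "\<dots> \<le> liminf (\<lambda>n. ennreal (K * r powr (1 - q)))"
  proof (intro Liminf_mono always_eventually allI)
    fix n
    show "(\<integral>\<^sup>+x. ennreal (\<bar>tree_value N A X n x r - tree_value N A Y n x r\<bar> powr \<delta>) \<partial>samples) \<le> ennreal (K * r powr (1 - q))"
      using tree_value_moment[of "\<lambda>p. X p - Y p" \<delta> q K r 0 n, OF _ \<delta> A_nonneg q K r] \<delta>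
      by (simp add: tree_value_diff)
  qed
  also have "\<dots> = ennreal (K * r powr (1 - q))" by (simp add: Liminf_const)
  finally show ?thesis .
qed

end

section \<open>Fixed point equations for the two initial data\<close>

text \<open>The factor \<open>\<tau>\<close> plays the part of the integrating factor e^t: with s =
  ln \<open>\<tau>\<close> - ln r the function \<open>\<tau>\<close> * char (V s)
  \<open>\<xi>\<close> has derivative G s, where G is the gain term of the equation. Integrating
  from r, where s = 0, to 1, where s = -ln r, gives the claim.\<close>

lemma mild_solution:
  fixes V :: "real \<Rightarrow> real measure" and M :: "'a measure"
  assumes M: "prob_space M"
    and A_meas: "\<And>i. i < N \<Longrightarrow> A i \<in> borel_measurable M"
    and V_distr: "\<And>t. t \<ge> 0 \<Longrightarrow> real_distribution (V t)"
    and V_ode: "\<And>t \<xi>. t \<ge> 0 \<Longrightarrow>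
        ((\<lambda>s. char (V s) \<xi>) has_vector_derivative
           (- char (V t) \<xi> + integral\<^sup>L M (\<lambda>\<omega>. \<Prod>i<N. char (V t) (A i \<omega> * \<xi>))))
        (at t within {0..})"
    and r: "0 < r" "r \<le> 1"
  shows "(\<lambda>\<tau>. indicator {r..1} \<tau> *\<^sub>R (\<integral>\<omega>. (\<Prod>i<N. char (V (- ln (r / \<tau>))) (A i \<omega> * \<xi>)) \<partial>M)) \<in> borel_measurable borel" (is ?meas)
    and "char (V (- ln r)) \<xi> = r *\<^sub>R char (V 0) \<xi> +
      set_lebesgue_integral lborel {r..1} (\<lambda>\<tau>. \<integral>\<omega>. (\<Prod>i<N. char (V (- ln (r / \<tau>))) (A i \<omega> * \<xi>)) \<partial>M)" (is ?eq)
proof -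
  interpret prob_space M by fact
  define G where "G s = (\<integral>\<omega>. (\<Prod>i<N. char (V s) (A i \<omega> * \<xi>)) \<partial>M)" for s
  have cont: "continuous_on {0..} (\<lambda>s. char (V s) x)" for x
    unfolding continuous_on_eq_continuous_within
    using V_ode has_vector_derivative_continuous by fastforce
  have meas: "(\<lambda>\<omega>. \<Prod>i<N. char (V s) (A i \<omega> * \<xi>)) \<in> borel_measurable M" if "0 \<le> s" for s
    using real_distribution.char_measurable[OF V_distr[OF that]] A_meas
    by (intro borel_measurable_prod measurable_compose[of _ M borel "char (V s)"]) auto
  have prod_le: "norm (\<Prod>i<N. char (V s) (A i \<omega> * \<xi>)) \<le> 1" if "0 \<le> s" for s \<omega>
    unfolding prod_norm[symmetric]
    using real_distribution.cmod_char_le_1[OF V_distr[OF that]] by (intro prod_le_1) auto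
  \<comment> \<open>Continuity is what the fundamental theorem asks of the derivative; dominated
    convergence yields it along sequences.\<close>
  have G_cont: "continuous_on {0..} G"
    unfolding continuous_on_sequentially
  proof (intro allI ballI impI, elim conjE)
    fix u s assume s: "s \<in> {0::real..}" and u: "\<forall>n. u n \<in> {0..}" "u \<longlonglongrightarrow> s"
    show "(G \<circ> u) \<longlonglongrightarrow> G s"
      unfolding G_def comp_def
    proof (rule integral_dominated_convergence[where w="\<lambda>_. 1"])
      show "AE \<omega> in M. (\<lambda>n. \<Prod>i<N. char (V (u n)) (A i \<omega> * \<xi>)) \<longlonglongrightarrow> (\<Prod>i<N. char (V s) (A i \<omega> * \<xi>))"
        using cont u s unfolding continuous_on_sequentially comp_def
        by (intro AE_I2 tendsto_prod) blast
    qed (use meas prod_le u s in auto)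
  qed
  define \<phi> where "\<phi> \<tau> = - ln (r / \<tau>)" for \<tau>
  have \<phi>: "\<phi> \<tau> = ln \<tau> - ln r" if "\<tau> \<in> {r..1}" for \<tau>
    using that r by (simp add: \<phi>_def ln_div)
  have \<phi>0: "\<phi> \<tau> \<in> {0..}" if "\<tau> \<in> {r..1}" for \<tau>
    using that r \<phi>[OF that] by simp
  have \<phi>_cont: "continuous_on {r..1} \<phi>"
    unfolding \<phi>_def using r by (auto intro!: continuous_intros)
  have G\<phi>: "continuous_on {r..1} (\<lambda>\<tau>. G (\<phi> \<tau>))"
    by (rule continuous_on_compose2[OF G_cont \<phi>_cont]) (use \<phi>0 in blast)
  show ?meas
    using borel_measurable_continuous_on_indicator[OF _ G\<phi>] by (simp add: G_def \<phi>_def)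
  have "integral\<^sup>L lborel (\<lambda>\<tau>. indicator {r..1} \<tau> *\<^sub>R G (\<phi> \<tau>)) = 1 *\<^sub>R char (V (\<phi> 1)) \<xi> - r *\<^sub>R char (V (\<phi> r)) \<xi>"
  proof (rule integral_FTC_atLeastAtMost[OF r(2) _ G\<phi>])
    fix \<tau> assume "r \<le> \<tau>" "\<tau> \<le> 1"
    then have \<tau>: "\<tau> \<in> {r..1}" "0 < \<tau>" using r by auto
    have "(\<phi> has_vector_derivative 1 / \<tau>) (at \<tau> within {r..1})"
    proof (rule has_vector_derivative_transform[OF \<tau>(1) \<phi>])
      show "((\<lambda>\<tau>. ln \<tau> - ln r) has_vector_derivative 1 / \<tau>) (at \<tau> within {r..1})"
        using \<tau> by (auto intro!: derivative_eq_intros simp: has_real_derivative_iff_has_vector_derivative[symmetric])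
    qed
    \<comment> \<open>At time 0 the derivative is one-sided, so the chain rule is applied within the
      image of [r,1], which lies in \<open>{0..}\<close>.\<close>
    moreover have "((\<lambda>s. char (V s) \<xi>) has_vector_derivative (- char (V (\<phi> \<tau>)) \<xi> + G (\<phi> \<tau>))) (at (\<phi> \<tau>) within \<phi> ` {r..1})"
      using \<phi>0 unfolding G_def
      by (intro has_vector_derivative_within_subset[OF V_ode] image_subsetI) (use \<tau> in auto)
    ultimately have "((\<lambda>\<tau>. char (V (\<phi> \<tau>)) \<xi>) has_vector_derivative (1 / \<tau>) *\<^sub>R (- char (V (\<phi> \<tau>)) \<xi> + G (\<phi> \<tau>))) (at \<tau> within {r..1})"
      by (rule vector_diff_chain_within[unfolded comp_def])
    then have "((\<lambda>\<tau>. \<tau> *\<^sub>R char (V (\<phi> \<tau>)) \<xi>) has_vector_derivative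
        (\<tau> *\<^sub>R (1 / \<tau>) *\<^sub>R (- char (V (\<phi> \<tau>)) \<xi> + G (\<phi> \<tau>)) + 1 *\<^sub>R char (V (\<phi> \<tau>)) \<xi>)) (at \<tau> within {r..1})"
      by (intro has_vector_derivative_scaleR DERIV_ident)
    then show "((\<lambda>\<tau>. \<tau> *\<^sub>R char (V (\<phi> \<tau>)) \<xi>) has_vector_derivative G (\<phi> \<tau>)) (at \<tau> within {r..1})"
      using \<tau> by simp
  qed
  then show ?eq
    using r by (simp add: \<phi>_def G_def set_lebesgue_integral_def)
qed

text \<open>The absolute value makes the integrand bounded by 1 on the whole line when Re s \<ge> 0.
  For a law carried by [0,\<infinity>) this is the usual Laplace transform.\<close>

definition laplace :: "real measure \<Rightarrow> complex \<Rightarrow> complex" where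
  "laplace \<zeta> s = (\<integral>x. exp (- s * complex_of_real \<bar>x\<bar>) \<partial>\<zeta>)"

lemma norm_exp_neg_le: "0 \<le> Re s \<Longrightarrow> 0 \<le> x \<Longrightarrow> norm (exp (- s * complex_of_real x)) \<le> 1"
  by simp

text \<open>The fixed point equation is known on the imaginary axis only; it says that \<open>\<zeta>\<close> is the law of
  \<open>\<Sum>i. A i powr \<gamma> * \<tau> powr Q * z i\<close>, and this identity of laws carries it to the half plane.\<close>

lemma laplace_fixed_point:
  fixes A :: "nat \<Rightarrow> 'a \<Rightarrow> real"
  assumes M: "prob_space M"
    and A_meas: "\<And>i. i < N \<Longrightarrow> A i \<in> borel_measurable M"
    and zeta: "real_distribution \<zeta>"
    and zeta_supp: "AE x in \<zeta>. 0 \<le> x"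
    and zeta_eq: "\<And>\<xi>. char \<zeta> \<xi> = set_lebesgue_integral lborel {0..1::real}
          (\<lambda>\<tau>. integral\<^sup>L M (\<lambda>\<omega>. \<Prod>i<N. char \<zeta> (\<xi> * A i \<omega> powr \<gamma> * \<tau> powr Q)))"
    and s: "0 \<le> Re s"
  shows "laplace \<zeta> s = (\<integral>\<tau>. \<integral>\<omega>. (\<Prod>i<N. laplace \<zeta> (s * complex_of_real (A i \<omega> powr \<gamma> * \<tau> powr Q))) \<partial>M \<partial>uniform01)"
proof -
  interpret Z: real_distribution \<zeta> by fact
  interpret M: prob_space M by fact
  interpret U: prob_space uniform01 by (rule prob_space_uniform01)
  interpret ZN: prob_space "PiM {..<N} (\<lambda>_. \<zeta>)" by (intro prob_space_PiM Z.prob_space_axioms)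
  interpret MZ: pair_prob_space M "PiM {..<N} (\<lambda>_. \<zeta>)" ..
  let ?MZ = "M \<Otimes>\<^sub>M PiM {..<N} (\<lambda>_. \<zeta>)"
  let ?J = "uniform01 \<Otimes>\<^sub>M ?MZ"
  interpret J: pair_prob_space uniform01 ?MZ ..
  have A' [measurable]: "\<And>i. i \<in> {..<N} \<Longrightarrow> A i \<in> borel_measurable M" using A_meas by simp
  have y [measurable]: "\<And>i. i \<in> {..<N} \<Longrightarrow> (\<lambda>y. y i) \<in> borel_measurable (PiM {..<N} (\<lambda>_. \<zeta>))"
    using measurable_component_singleton[of _ "{..<N}" "\<lambda>_. \<zeta>"] by simp
  define T where "T q = (\<Sum>i<N. A i (fst (snd q)) powr \<gamma> * fst q powr Q * \<bar>snd (snd q) i\<bar>)" for q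
  have T_meas [measurable]: "T \<in> borel_measurable ?J"
    unfolding T_def by measurable
  have T0: "0 \<le> T q" for q
    unfolding T_def by (intro sum_nonneg) auto
  \<comment> \<open>Proved on the closed half plane because it is used twice: on the imaginary axis
    to find the law of \<open>T\<close>, then at the given \<open>s\<close>.\<close>
  have T_law: "(\<integral>q. exp (- s * complex_of_real (T q)) \<partial>?J)
      = (\<integral>\<tau>. \<integral>\<omega>. (\<Prod>i<N. laplace \<zeta> (s * complex_of_real (A i \<omega> powr \<gamma> * \<tau> powr Q))) \<partial>M \<partial>uniform01)"
    if s: "0 \<le> Re s" for s
  proof -
    have "(\<integral>q. exp (- s * complex_of_real (T q)) \<partial>?J) = (\<integral>\<tau>. \<integral>z. exp (- s * complex_of_real (T (\<tau>, z))) \<partial>?MZ \<partial>uniform01)"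
      by (rule integral_pair_bounded[OF U.prob_space_axioms MZ.prob_space_axioms _ norm_exp_neg_le[OF s T0]]) measurable
    also have "\<dots> = (\<integral>\<tau>. \<integral>\<omega>. \<integral>y. exp (- s * complex_of_real (T (\<tau>, \<omega>, y))) \<partial>PiM {..<N} (\<lambda>_. \<zeta>) \<partial>M \<partial>uniform01)"
      by (intro Bochner_Integration.integral_cong refl
          integral_pair_bounded[OF M ZN.prob_space_axioms _ norm_exp_neg_le[OF s T0]]) measurable
    also have "\<dots> = (\<integral>\<tau>. \<integral>\<omega>. (\<Prod>i<N. laplace \<zeta> (s * complex_of_real (A i \<omega> powr \<gamma> * \<tau> powr Q))) \<partial>M \<partial>uniform01)"
    proof (intro Bochner_Integration.integral_cong refl)
      fix \<tau> \<omega>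
      have "(\<integral>y. exp (- s * complex_of_real (T (\<tau>, \<omega>, y))) \<partial>PiM {..<N} (\<lambda>_. \<zeta>))
        = (\<integral>y. (\<Prod>i<N. exp (- (s * complex_of_real (A i \<omega> powr \<gamma> * \<tau> powr Q)) * complex_of_real \<bar>y i\<bar>)) \<partial>PiM {..<N} (\<lambda>_. \<zeta>))"
        by (intro Bochner_Integration.integral_cong refl)
          (simp add: T_def exp_sum[symmetric] sum_distrib_left sum_negf mult_ac)
      also have "\<dots> = (\<Prod>i<N. laplace \<zeta> (s * complex_of_real (A i \<omega> powr \<gamma> * \<tau> powr Q)))"
        unfolding laplace_def
        using s by (intro integral_iid_prod Z.prob_space_axioms norm_exp_neg_le) (measurable, auto)
      finally show "(\<integral>y. exp (- s * complex_of_real (T (\<tau>, \<omega>, y))) \<partial>PiM {..<N} (\<lambda>_. \<zeta>))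
        = (\<Prod>i<N. laplace \<zeta> (s * complex_of_real (A i \<omega> powr \<gamma> * \<tau> powr Q)))" .
    qed
    finally show ?thesis .
  qed
  have char_laplace: "char \<zeta> \<xi> = laplace \<zeta> (- \<i> * complex_of_real \<xi>)" for \<xi>
    unfolding char_def laplace_def using zeta_supp
    by (intro integral_cong_AE) (auto elim!: eventually_mono simp: mult.assoc)
  have char_meas [measurable]: "char \<zeta> \<in> borel_measurable borel" by (rule Z.char_measurable)
  have "distr ?J borel T = \<zeta>"
  proof (rule Levy_uniqueness[OF _ zeta])
    show "real_distribution (distr ?J borel T)"
      by (intro J.real_distribution_distr) measurable
    show "char (distr ?J borel T) = char \<zeta>"
    proof
      fix \<xi>
      have "char (distr ?J borel T) \<xi> = (\<integral>q. exp (- (- \<i> * complex_of_real \<xi>) * complex_of_real (T q)) \<partial>?J)"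
        unfolding char_def by (subst integral_distr) (auto simp: mult.assoc)
      also have "\<dots> = (\<integral>\<tau>. \<integral>\<omega>. (\<Prod>i<N. char \<zeta> (\<xi> * A i \<omega> powr \<gamma> * \<tau> powr Q)) \<partial>M \<partial>uniform01)"
        by (subst T_law) (simp_all add: char_laplace mult_ac)
      also have "\<dots> = char \<zeta> \<xi>"
        unfolding zeta_eq[of \<xi>] by (rule integral_uniform01) measurable
      finally show "char (distr ?J borel T) \<xi> = char \<zeta> \<xi>" .
    qed
  qed
  then have "laplace \<zeta> s = laplace (distr ?J borel T) s" by simp
  also have "\<dots> = (\<integral>q. exp (- s * complex_of_real (T q)) \<partial>?J)"
    unfolding laplace_def using T0 by (subst integral_distr) auto
  finally show ?thesis using T_law[OF s] by simp
qed

text \<open>All branches of \<open>ghat\<close> are strictly stable of index \<gamma>: \<xi> enters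
  through its sign and through |\<xi>|^\<gamma> only. In the finite mean case \<kappa> is purely
  imaginary; in the last case its real part is \<open>k0\<close>, which is nonnegative since pi *
  \<gamma> / 2 lies in (0,pi).\<close>

lemma ghat_eq_exp:
  assumes \<gamma>: "0 < \<gamma>" "\<gamma> < 2" and H: "H_gamma \<gamma> mu0 cp cm"
  obtains \<kappa> where "\<And>x. 0 \<le> Re (\<kappa> x)" "\<And>\<xi>. ghat \<gamma> mu0 cp cm \<xi> = exp (- (\<kappa> (sgn \<xi>) * complex_of_real (\<bar>\<xi>\<bar> powr \<gamma>)))"
proof (cases "\<gamma> = 1")
  case True
  show ?thesis
  proof (cases "integrable mu0 (\<lambda>v. v)")
    case int: True
    define m where "m = integral\<^sup>L mu0 (\<lambda>v. v)"
    have eq: "\<i> * complex_of_real (m * \<xi>) = - (- \<i> * complex_of_real (m * sgn \<xi>) * complex_of_real (\<bar>\<xi>\<bar> powr \<gamma>))" for \<xi>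
    proof -
      have "m * \<xi> = m * sgn \<xi> * \<bar>\<xi>\<bar> powr \<gamma>"
        by (simp add: True sgn_mult_abs mult.assoc)
      then show ?thesis by (simp only: of_real_mult) simp
    qed
    show ?thesis
    proof (rule that[of "\<lambda>x. - \<i> * complex_of_real (m * x)"])
      fix \<xi>
      have "ghat \<gamma> mu0 cp cm \<xi> = exp (\<i> * complex_of_real (m * \<xi>))"
        using True int by (simp add: ghat_def m_def)
      then show "ghat \<gamma> mu0 cp cm \<xi> = exp (- (- \<i> * complex_of_real (m * sgn \<xi>) * complex_of_real (\<bar>\<xi>\<bar> powr \<gamma>)))"
        by (simp only: eq)
    qed simp
  next
    case False
    then have "0 < cp" using True H by (auto simp: H_gamma_def)
    then show ?thesis
      using True False by (intro that[of "\<lambda>_. complex_of_real (pi * cp)"])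
        (auto simp: ghat_def exp_of_real[symmetric])
  qed
next
  case False
  then have c: "0 < cp + cm" using H by (auto simp: H_gamma_def)
  define k0 where "k0 = (cp + cm) * pi / (2 * Gamma \<gamma> * sin (pi * \<gamma> / 2))"
  have "0 < sin (pi * \<gamma> / 2)" using \<gamma> by (intro sin_gt_zero) auto
  then have k0: "0 \<le> k0"
    unfolding k0_def using c \<gamma> Gamma_real_pos[of \<gamma>] by auto
  define \<kappa> where "\<kappa> x = complex_of_real k0 * (1 - \<i> * complex_of_real ((cp - cm) / (cp + cm) * tan (pi * \<gamma> / 2) * x))" for x
  have "0 \<le> Re (\<kappa> x)" for x
    using k0 by (simp add: \<kappa>_def)
  moreover have "ghat \<gamma> mu0 cp cm \<xi> = exp (- (\<kappa> (sgn \<xi>) * complex_of_real (\<bar>\<xi>\<bar> powr \<gamma>)))" for \<xi>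
    using False by (simp add: ghat_def Let_def \<kappa>_def k0_def mult_ac)
  ultimately show ?thesis by (rule that)
qed

lemma measurable_comp_sgn:
  "(\<lambda>\<xi>. \<kappa> (sgn \<xi>) :: complex) \<in> borel_measurable (borel :: real measure)"
proof -
  have "(\<lambda>\<xi>. \<kappa> (sgn \<xi>)) = (\<lambda>\<xi>::real. if 0 < \<xi> then \<kappa> 1 else if \<xi> < 0 then \<kappa> (- 1) else \<kappa> 0)"
    by (auto simp: sgn_if)
  then show ?thesis by simp
qed

text \<open>The scale z^(1/\<gamma>) keeps the sign of \<xi> and multiplies |\<xi>|^\<gamma> by z.
  The mixture is therefore a transform of the mixing law at one point of the half plane.\<close>

lemma integral_ghat_eq_laplace:
  assumes zeta: "real_distribution \<zeta>" and supp: "AE x in \<zeta>. 0 \<le> x" and \<gamma>: "0 < \<gamma>"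
    and \<kappa>: "\<And>\<xi>. g \<xi> = exp (- (\<kappa> (sgn \<xi>) * complex_of_real (\<bar>\<xi>\<bar> powr \<gamma>)))"
  shows "(\<integral>z. g (\<xi> * z powr (1 / \<gamma>)) \<partial>\<zeta>) = laplace \<zeta> (\<kappa> (sgn \<xi>) * complex_of_real (\<bar>\<xi>\<bar> powr \<gamma>))"
proof -
  interpret Z: real_distribution \<zeta> by fact
  have [measurable]: "g \<in> borel_measurable borel"
    using measurable_comp_sgn[measurable] unfolding \<kappa> [abs_def] by measurable
  show ?thesis
    unfolding laplace_def
  proof (rule integral_cong_AE)
    show "AE z in \<zeta>. g (\<xi> * z powr (1 / \<gamma>)) = exp (- (\<kappa> (sgn \<xi>) * complex_of_real (\<bar>\<xi>\<bar> powr \<gamma>)) * complex_of_real \<bar>z\<bar>)"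
      using supp
    proof eventually_elim
      case (elim z)
      show ?case
      \<comment> \<open>At z = 0 the sign jumps to 0 and \<kappa> changes, but it is multiplied by 0
        on both sides.\<close>
      proof (cases "z = 0")
        case False
        with elim have z: "0 < z" by simp
        then have "\<bar>\<xi> * z powr (1 / \<gamma>)\<bar> powr \<gamma> = \<bar>\<xi>\<bar> powr \<gamma> * z"
          using \<gamma> by (simp add: abs_mult powr_mult powr_powr)
        moreover have "sgn (\<xi> * z powr (1 / \<gamma>)) = sgn \<xi>"
          using z by (simp add: sgn_mult)
        ultimately show ?thesis using z by (simp add: \<kappa> mult.assoc)
      qed (simp add: \<kappa>)
    qed
  qed measurable
qed

text \<open>The weight A_i^\<gamma> * \<tau>^Q acting on the transform is the \<gamma>-th power of c
  = A_i * \<tau>^(Q/\<gamma>). As c \<ge> 0, it scales \<xi> without changing its sign; this is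
  where the rate Q / \<gamma> arises.\<close>

lemma char_fixed_point:
  fixes A :: "nat \<Rightarrow> 'a \<Rightarrow> real"
  assumes \<gamma>: "0 < \<gamma>"
    and A_nonneg: "\<And>i \<omega>. i < N \<Longrightarrow> \<omega> \<in> space M \<Longrightarrow> 0 \<le> A i \<omega>"
    and fp: "\<And>s. 0 \<le> Re s \<Longrightarrow> laplace \<zeta> s =
      (\<integral>\<tau>. \<integral>\<omega>. (\<Prod>i<N. laplace \<zeta> (s * complex_of_real (A i \<omega> powr \<gamma> * \<tau> powr Q))) \<partial>M \<partial>uniform01)"
    and \<kappa>: "\<And>x. 0 \<le> Re (\<kappa> x)"
    and \<psi>: "\<And>\<xi>. \<psi> \<xi> = laplace \<zeta> (\<kappa> (sgn \<xi>) * complex_of_real (\<bar>\<xi>\<bar> powr \<gamma>))"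
  shows "\<psi> \<xi> = (\<integral>\<tau>. \<integral>\<omega>. (\<Prod>i<N. \<psi> (A i \<omega> * \<tau> powr (Q / \<gamma>) * \<xi>)) \<partial>M \<partial>uniform01)"
proof -
  have "laplace \<zeta> (\<kappa> (sgn \<xi>) * complex_of_real (\<bar>\<xi>\<bar> powr \<gamma>) * complex_of_real (A i \<omega> powr \<gamma> * \<tau> powr Q))
      = \<psi> (A i \<omega> * \<tau> powr (Q / \<gamma>) * \<xi>)" if "i < N" "\<omega> \<in> space M" for i \<omega> \<tau>
  proof -
    define c where "c = A i \<omega> * \<tau> powr (Q / \<gamma>)"
    have A: "0 \<le> A i \<omega>" using A_nonneg that by simp
    then have c: "0 \<le> c" by (simp add: c_def)
    have c\<gamma>: "c powr \<gamma> = A i \<omega> powr \<gamma> * \<tau> powr Q"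
      using A \<gamma> by (simp add: c_def powr_mult powr_powr)
    show ?thesis
      unfolding c_def[symmetric] c\<gamma>[symmetric] \<psi>
      using c by (cases "c = 0") (auto simp: sgn_mult abs_mult powr_mult mult_ac)
  qed
  then show ?thesis
    unfolding \<psi>[of \<xi>]
    by (subst fp) (auto intro!: Bochner_Integration.integral_cong prod.cong simp: \<kappa> simp del: of_real_mult)
qed

text \<open>Self-similarity: apply the fixed point equation at the rescaled frequency and cut [0,1]
  at r. On [0,r) the substitution \<tau> = r * \<tau>' restores the whole equation at \<xi>, giving
  the leaf term; on [r,1] the integrand is already that of the rescaled curve at r / \<tau>.\<close>

lemma char_mild_solution:
  fixes A :: "nat \<Rightarrow> 'a \<Rightarrow> real" and \<psi> :: "real \<Rightarrow> complex"
  assumes M: "prob_space M"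
    and A_meas: "\<And>i. i < N \<Longrightarrow> A i \<in> borel_measurable M"
    and \<psi>_meas: "\<psi> \<in> borel_measurable borel" and \<psi>_le: "\<And>\<xi>. norm (\<psi> \<xi>) \<le> 1"
    and fp: "\<And>\<xi>. \<psi> \<xi> = (\<integral>\<tau>. \<integral>\<omega>. (\<Prod>i<N. \<psi> (A i \<omega> * \<tau> powr \<mu> * \<xi>)) \<partial>M \<partial>uniform01)"
    and r: "0 < r" "r \<le> 1"
  shows "(\<lambda>\<tau>. indicator {r..1} \<tau> *\<^sub>R (\<integral>\<omega>. (\<Prod>i<N. \<psi> ((r / \<tau>) powr - \<mu> * (A i \<omega> * \<xi>))) \<partial>M)) \<in> borel_measurable borel" (is ?meas)
    and "\<psi> (r powr - \<mu> * \<xi>) = r *\<^sub>R \<psi> \<xi> +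
      set_lebesgue_integral lborel {r..1} (\<lambda>\<tau>. \<integral>\<omega>. (\<Prod>i<N. \<psi> ((r / \<tau>) powr - \<mu> * (A i \<omega> * \<xi>))) \<partial>M)" (is ?eq)
proof -
  interpret prob_space M by fact
  note [measurable] = \<psi>_meas
  have A' [measurable]: "\<And>i. i \<in> {..<N} \<Longrightarrow> A i \<in> borel_measurable M" using A_meas by simp
  show ?meas by measurable
  define H where "H x \<tau> = (\<integral>\<omega>. (\<Prod>i<N. \<psi> (A i \<omega> * \<tau> powr \<mu> * x)) \<partial>M)" for x \<tau>
  have H_meas [measurable]: "H x \<in> borel_measurable borel" for x
    unfolding H_def by measurable
  have H_le: "norm (H x \<tau>) \<le> 1" for x \<tau>
    unfolding H_def by (intro norm_integral_le_const) (auto simp: prod_norm[symmetric] intro!: prod_le_1 \<psi>_le)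
  have int: "integrable lborel (\<lambda>\<tau>. indicator S \<tau> *\<^sub>R H x \<tau>)" if [measurable]: "S \<in> sets borel" and S: "S \<subseteq> {0..1}" for x S
  proof (rule integrableI_bounded_set[where A=S and B=1])
    have "emeasure lborel S \<le> emeasure lborel {0..1::real}"
      using S by (intro emeasure_mono) auto
    then show "emeasure lborel S < \<infinity>" by (simp add: less_top le_less_trans)
  qed (auto simp: H_le split: split_indicator)
  have \<psi>_H: "\<psi> x = (\<integral>\<tau>. indicator {0..1} \<tau> *\<^sub>R H x \<tau> \<partial>lborel)" for x
    unfolding fp[of x] H_def[symmetric] by (subst integral_uniform01) (auto simp: set_lebesgue_integral_def)
  \<comment> \<open>Chosen so that shrinking \<open>\<tau>\<close> by the factor r brings the
    frequency back to \<open>\<xi>\<close>.\<close>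
  define x where "x = r powr - \<mu> * \<xi>"
  have scale: "H x (r * \<tau>) = H \<xi> \<tau>" if "0 \<le> \<tau>" for \<tau>
  proof -
    have "(r * \<tau>) powr \<mu> * r powr - \<mu> = \<tau> powr \<mu>"
      using r that by (simp add: powr_mult powr_minus)
    then have "A i \<omega> * (r * \<tau>) powr \<mu> * x = A i \<omega> * \<tau> powr \<mu> * \<xi>" for i \<omega>
      by (simp add: x_def mult.assoc)
    then show ?thesis by (simp only: H_def)
  qed
  have "\<psi> x = (\<integral>\<tau>. indicator {0..<r} \<tau> *\<^sub>R H x \<tau> + indicator {r..1} \<tau> *\<^sub>R H x \<tau> \<partial>lborel)"
    unfolding \<psi>_H[of x] using r by (intro Bochner_Integration.integral_cong) (auto split: split_indicator)
  also have "\<dots> = (\<integral>\<tau>. indicator {0..<r} \<tau> *\<^sub>R H x \<tau> \<partial>lborel) + (\<integral>\<tau>. indicator {r..1} \<tau> *\<^sub>R H x \<tau> \<partial>lborel)"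
    using r by (intro Bochner_Integration.integral_add int) auto
  also have "(\<integral>\<tau>. indicator {0..<r} \<tau> *\<^sub>R H x \<tau> \<partial>lborel)
    = \<bar>r\<bar> *\<^sub>R (\<integral>\<tau>. indicator {0..<r} (0 + r * \<tau>) *\<^sub>R H x (0 + r * \<tau>) \<partial>lborel)"
    using r by (intro lborel_integral_real_affine) auto
  also have "(\<integral>\<tau>. indicator {0..<r} (0 + r * \<tau>) *\<^sub>R H x (0 + r * \<tau>) \<partial>lborel) = (\<integral>\<tau>. indicator {0..<1} \<tau> *\<^sub>R H \<xi> \<tau> \<partial>lborel)"
    using r by (intro Bochner_Integration.integral_cong refl)
      (auto simp: scale zero_le_mult_iff split: split_indicator)
  also have "\<dots> = (\<integral>\<tau>. indicator {0..1} \<tau> *\<^sub>R H \<xi> \<tau> \<partial>lborel)"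
    using AE_lborel_singleton[of "1::real"]
    by (intro integral_cong_AE) (auto elim!: eventually_mono split: split_indicator)
  also have "\<dots> = \<psi> \<xi>" by (rule \<psi>_H[symmetric])
  also have "(\<integral>\<tau>. indicator {r..1} \<tau> *\<^sub>R H x \<tau> \<partial>lborel) =
      set_lebesgue_integral lborel {r..1} (\<lambda>\<tau>. \<integral>\<omega>. (\<Prod>i<N. \<psi> ((r / \<tau>) powr - \<mu> * (A i \<omega> * \<xi>))) \<partial>M)"
    unfolding set_lebesgue_integral_def
  proof (intro Bochner_Integration.integral_cong refl)
    fix \<tau>
    show "indicator {r..1} \<tau> *\<^sub>R H x \<tau> = indicator {r..1} \<tau> *\<^sub>R (\<integral>\<omega>. (\<Prod>i<N. \<psi> ((r / \<tau>) powr - \<mu> * (A i \<omega> * \<xi>))) \<partial>M)"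
    proof (cases "\<tau> \<in> {r..1}")
      case True
      then have "A i \<omega> * \<tau> powr \<mu> * x = (r / \<tau>) powr - \<mu> * (A i \<omega> * \<xi>)" for i \<omega>
        using r by (simp add: x_def powr_divide powr_minus field_simps)
      then show ?thesis by (simp only: H_def)
    qed simp
  qed
  finally show ?eq using r by (simp add: x_def)
qed

lemma norm_exp_minus_one_le:
  assumes "Re w \<le> 0"
  shows "norm (exp w - 1) \<le> norm w"
proof -
  \<comment> \<open>Mean value bound on the left half plane, which is convex and on which the
    derivative of exp has norm at most 1.\<close>
  have "norm (exp w - exp 0) \<le> 1 * norm (w - 0)"
    by (rule field_differentiable_bound[of "{z. Re z \<le> 0}"])
      (use assms in \<open>auto intro!: DERIV_exp[THEN has_field_derivative_at_within] convex_halfspace_Re_le\<close>)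
  then show ?thesis by simp
qed

text \<open>First order control at 0 from a finite first moment. At s proportional to \<xi>^\<gamma>
  it bounds the deviation of the characteristic function of the limit from 1 by a multiple of
  \<xi>^\<gamma>.\<close>

lemma laplace_minus_one_le:
  assumes zeta: "real_distribution \<zeta>" and int: "integrable \<zeta> (\<lambda>x. x)" and s: "0 \<le> Re s"
  shows "norm (laplace \<zeta> s - 1) \<le> norm s * (\<integral>x. \<bar>x\<bar> \<partial>\<zeta>)"
proof -
  interpret Z: real_distribution \<zeta> by fact
  have "laplace \<zeta> s - 1 = (\<integral>x. exp (- s * complex_of_real \<bar>x\<bar>) - 1 \<partial>\<zeta>)"
    unfolding laplace_def using Z.prob_space
    by (subst Bochner_Integration.integral_diff) (auto intro!: Z.integrable_const_bound[of _ 1] simp: s)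
  also have "norm \<dots> \<le> (\<integral>x. norm s * \<bar>x\<bar> \<partial>\<zeta>)"
  proof (rule Bochner_Integration.integral_norm_bound_integral)
    fix x :: real
    show "norm (exp (- s * complex_of_real \<bar>x\<bar>) - 1) \<le> norm s * \<bar>x\<bar>"
      using norm_exp_minus_one_le[of "- s * complex_of_real \<bar>x\<bar>"] s by (simp add: norm_mult)
    show "integrable \<zeta> (\<lambda>x. norm s * \<bar>x\<bar>)" using int by simp
    show "integrable \<zeta> (\<lambda>x. exp (- s * complex_of_real \<bar>x\<bar>) - 1)"
      by (intro Bochner_Integration.integrable_diff Z.integrable_const_bound[of _ 1]) (auto simp: s)
  qed
  finally show ?thesis by simp
qed

section \<open>Centered couplings\<close>

lemma integral_odd_eq_0:
  fixes f :: "real \<Rightarrow> real"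
  assumes "sets \<mu> = sets borel" "distr \<mu> borel uminus = \<mu>" "f \<in> borel_measurable borel" "\<And>x. f (- x) = - f x"
  shows "(\<integral>x. f x \<partial>\<mu>) = 0"
proof -
  have u: "uminus \<in> borel_measurable \<mu>"
    using assms(1) by (simp cong: measurable_cong_sets)
  have "(\<integral>x. f x \<partial>\<mu>) = (\<integral>x. f x \<partial>distr \<mu> borel uminus)"
    using assms(2) by simp
  also have "\<dots> = (\<integral>x. f (- x) \<partial>\<mu>)"
    using u assms(3) by (rule integral_distr)
  finally show ?thesis by (simp add: assms(4))
qed

text \<open>Neither marginal need be integrable, hence the truncation.\<close>

lemma expectation_diff_symmetric:
  fixes X Y :: "'a \<Rightarrow> real"
  assumes "prob_space P" and X [measurable]: "X \<in> borel_measurable P" and Y [measurable]: "Y \<in> borel_measurable P"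
    and int: "integrable P (\<lambda>p. X p - Y p)"
    and symX: "distr (distr P borel X) borel uminus = distr P borel X"
    and symY: "distr (distr P borel Y) borel uminus = distr P borel Y"
  shows "(\<integral>p. X p - Y p \<partial>P) = 0"
proof -
  interpret prob_space P by fact
  define clip :: "nat \<Rightarrow> real \<Rightarrow> real" where "clip n x = max (- real n) (min (real n) x)" for n x
  have clip_meas [measurable]: "clip n \<in> borel_measurable borel" for n
    unfolding clip_def by measurable
  have clip_le: "\<bar>clip n x\<bar> \<le> real n" for n x
    by (auto simp: clip_def)
  \<comment> \<open>The Lipschitz bound makes |X - Y| a dominating function for the difference of
    the truncations.\<close>
  have clip_diff: "\<bar>clip n x - clip n y\<bar> \<le> \<bar>x - y\<bar>" for n x y
    by (auto simp: clip_def max_def min_def)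
  have clip_lim: "(\<lambda>n. clip n x) \<longlonglongrightarrow> x" for x
  proof (rule tendsto_eventually)
    show "\<forall>\<^sub>F n in sequentially. clip n x = x"
      using eventually_ge_at_top[of "nat \<lceil>\<bar>x\<bar>\<rceil>"]
    proof eventually_elim
      case (elim n)
      then have "\<bar>x\<bar> \<le> real n" by linarith
      then show ?case by (auto simp: clip_def)
    qed
  qed
  have zero: "(\<integral>p. clip n (Z p) \<partial>P) = 0" if [measurable]: "Z \<in> borel_measurable P"
    and sym: "distr (distr P borel Z) borel uminus = distr P borel Z" for Z n
  proof -
    have "(\<integral>p. clip n (Z p) \<partial>P) = (\<integral>x. clip n x \<partial>distr P borel Z)"
      by (simp add: integral_distr)
    also have "\<dots> = 0"
      by (rule integral_odd_eq_0[OF _ sym clip_meas]) (auto simp: clip_def max_def min_def)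
    finally show ?thesis .
  qed
  have "(\<lambda>n. \<integral>p. clip n (X p) - clip n (Y p) \<partial>P) \<longlonglongrightarrow> (\<integral>p. X p - Y p \<partial>P)"
  proof (rule integral_dominated_convergence[where w="\<lambda>p. \<bar>X p - Y p\<bar>"])
    show "integrable P (\<lambda>p. \<bar>X p - Y p\<bar>)" using int by simp
  qed (auto intro!: tendsto_diff clip_lim clip_diff)
  moreover have "(\<integral>p. clip n (X p) - clip n (Y p) \<partial>P) = 0" for n
  proof -
    have "integrable P (\<lambda>p. clip n (X p))" "integrable P (\<lambda>p. clip n (Y p))"
      using clip_le by (auto intro!: integrable_const_bound[of _ "real n"])
    then show ?thesis
      by (simp add: zero[OF X symX] zero[OF Y symY])
  qed
  ultimately show ?thesis by (simp add: LIMSEQ_const_iff)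
qed

text \<open>The expectation of the ceiling of |v| is the sum of the tails, here of order
  n^(-\<gamma>) with \<gamma> > 1. Integrability has to be established separately, since a Bochner
  integral equal to 0 does not show it.\<close>

lemma integrable_of_powr_tails:
  assumes mu: "real_distribution mu" and \<gamma>: "1 < \<gamma>"
    and top: "((\<lambda>x. x powr \<gamma> * (1 - cdf mu x)) \<longlongrightarrow> cp) at_top"
    and bot: "((\<lambda>x. \<bar>x\<bar> powr \<gamma> * cdf mu x) \<longlongrightarrow> cm) at_bot"
  shows "integrable mu (\<lambda>v. v)"
proof -
  interpret real_distribution mu by fact
  define a where "a n = measure mu {x \<in> space mu. n < nat \<lceil>\<bar>x\<bar>\<rceil>}" for n
  \<comment> \<open>Eventually each tail, multiplied by n^\<gamma>, exceeds its limit by less than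
    1; this gives the 2 in the constant.\<close>
  have ev: "\<forall>\<^sub>F n in sequentially. norm (a n) \<le> (cp + cm + 2) * real n powr - \<gamma>"
  proof -
    have t: "\<forall>\<^sub>F n in sequentially. real n powr \<gamma> * (1 - cdf mu (real n)) < cp + 1"
      using filterlim_compose[OF top filterlim_real_sequentially]
      by (rule order_tendstoD) simp
    have "filterlim (\<lambda>n. - real n) at_bot sequentially"
      using filterlim_real_sequentially by (simp add: filterlim_uminus_at_top)
    from filterlim_compose[OF bot this]
    have b: "\<forall>\<^sub>F n in sequentially. \<bar>- real n\<bar> powr \<gamma> * cdf mu (- real n) < cm + 1"
      by (rule order_tendstoD) simp
    from t b eventually_gt_at_top[of 0] show ?thesis
    proof eventually_elim
      case (elim n)
      have "a n \<le> measure mu ({real n<..} \<union> {..- real n})"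
        unfolding a_def
      proof (intro finite_measure_mono subsetI)
        fix x assume "x \<in> {x \<in> space mu. n < nat \<lceil>\<bar>x\<bar>\<rceil>}"
        then have "real n < \<bar>x\<bar>" by (simp add: zless_nat_eq_int_zless less_ceiling_iff)
        then show "x \<in> {real n<..} \<union> {..- real n}" by auto
      qed auto
      also have "\<dots> \<le> measure mu {real n<..} + measure mu {..- real n}"
        by (intro measure_Un_le) auto
      also have "measure mu {real n<..} = 1 - cdf mu (real n)"
      proof -
        have "{real n<..} = space mu - {..real n}" by auto
        then show ?thesis using prob_compl[of "{..real n}"] by (simp add: cdf_def)
      qed
      also have "measure mu {..- real n} = cdf mu (- real n)" by (simp add: cdf_def)
      also have "1 - cdf mu (real n) + cdf mu (- real n) \<le> (cp + cm + 2) * real n powr - \<gamma>"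
        using elim by (simp add: powr_minus field_simps)
      finally show ?case by (simp add: a_def)
    qed
  qed
  have "summable (\<lambda>n. (cp + cm + 2) * real n powr - \<gamma>)"
    using \<gamma> by (intro summable_mult) (simp add: summable_real_powr_iff)
  then have a: "summable a"
    by (rule summable_comparison_test_ev[OF ev])
  have "(\<integral>\<^sup>+x. ennreal (norm x) \<partial>mu) \<le> (\<integral>\<^sup>+x. of_nat (nat \<lceil>\<bar>x\<bar>\<rceil>) \<partial>mu)"
    by (intro nn_integral_mono) (simp add: ennreal_of_nat_eq_real_of_nat real_nat_ceiling_ge)
  also have "\<dots> = (\<Sum>n. emeasure mu {x \<in> space mu. n < nat \<lceil>\<bar>x\<bar>\<rceil>})"
    by (rule nn_integral_nat_function) measurable
  also have "\<dots> = (\<Sum>n. ennreal (a n))"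
    by (simp add: a_def emeasure_eq_measure)
  also have "\<dots> < \<infinity>"
    unfolding infinity_ennreal_def less_top[symmetric]
    by (rule ennreal_suminf_neq_top[OF a]) (simp add: a_def)
  finally show ?thesis
    by (intro integrableI_bounded) auto
qed

text \<open>The mean times i is the derivative of the characteristic function at 0, and a deviation
  from 1 of order \<xi>^\<gamma> with \<gamma> > 1 forces this derivative to vanish.\<close>

lemma mean_zero_of_char:
  assumes mu: "real_distribution mu" and int: "integrable mu (\<lambda>x. x)" and \<gamma>: "1 < \<gamma>"
    and le: "\<And>\<xi>. 0 < \<xi> \<Longrightarrow> norm (char mu \<xi> - 1) \<le> C * \<xi> powr \<gamma>"
  shows "(\<integral>x. x \<partial>mu) = 0"
proof -
  interpret real_distribution mu by fact
  \<comment> \<open>Difference quotients at 0 along the steps 1 / Suc n; the Taylor bounds of order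
    0 and 1 give domination by |x| and convergence.\<close>
  define u where "u n x = complex_of_real (real (Suc n)) * (iexp (x / real (Suc n)) - 1)" for n x
  have u_int: "(\<integral>x. u n x \<partial>mu) = complex_of_real (real (Suc n)) * (char mu (1 / real (Suc n)) - 1)" for n
  proof -
    have "integrable mu (\<lambda>x. iexp (x / real (Suc n)))"
      by (rule integrable_const_bound[of _ 1]) auto
    then show ?thesis
      unfolding u_def char_def using prob_space by (simp del: of_nat_Suc)
  qed
  have "(\<lambda>n. \<integral>x. u n x \<partial>mu) \<longlonglongrightarrow> (\<integral>x. \<i> * complex_of_real x \<partial>mu)"
  proof (rule integral_dominated_convergence[where w="\<lambda>x. \<bar>x\<bar>"])
    show "AE x in mu. norm (u n x) \<le> \<bar>x\<bar>" for n
    proof (rule AE_I2)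
      fix x
      have "norm (iexp (x / real (Suc n)) - 1) \<le> \<bar>x\<bar> / real (Suc n)"
        using iexp_approx1[of "x / real (Suc n)" 0] by simp
      then have "real (Suc n) * norm (iexp (x / real (Suc n)) - 1) \<le> real (Suc n) * (\<bar>x\<bar> / real (Suc n))"
        by (intro mult_left_mono) auto
      then show "norm (u n x) \<le> \<bar>x\<bar>"
        unfolding u_def norm_mult norm_of_real by simp
    qed
    show "AE x in mu. (\<lambda>n. u n x) \<longlonglongrightarrow> \<i> * complex_of_real x"
    proof (rule AE_I2)
      fix x :: real
      show "(\<lambda>n. u n x) \<longlonglongrightarrow> \<i> * complex_of_real x"
      proof (rule Lim_transform2[OF tendsto_const], rule Lim_null_comparison)
        show "\<forall>\<^sub>F n in sequentially. norm (\<i> * complex_of_real x - u n x) \<le> x\<^sup>2 / 2 * inverse (real (Suc n))"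
        proof (rule always_eventually, rule allI)
          fix n
          define y where "y = x / real (Suc n)"
          have x: "complex_of_real x = complex_of_real (real (Suc n)) * complex_of_real y"
            by (simp add: y_def del: of_nat_Suc)
          have "norm (iexp y - 1 - \<i> * complex_of_real y) \<le> y\<^sup>2 / 2"
            using iexp_approx1[of y 1] by (simp add: power2_eq_square algebra_simps)
          then have *: "real (Suc n) * norm (iexp y - 1 - \<i> * complex_of_real y) \<le> real (Suc n) * (y\<^sup>2 / 2)"
            by (intro mult_left_mono) auto
          have "u n x - \<i> * complex_of_real x = complex_of_real (real (Suc n)) * (iexp y - 1 - \<i> * complex_of_real y)"
            unfolding u_def y_def[symmetric] x by (simp add: algebra_simps del: of_nat_Suc)
          then have "norm (u n x - \<i> * complex_of_real x) \<le> real (Suc n) * (y\<^sup>2 / 2)"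
            using * by (simp add: norm_mult del: of_nat_Suc)
          also have "\<dots> = x\<^sup>2 / 2 * inverse (real (Suc n))"
            by (simp add: y_def power_divide power2_eq_square field_simps del: of_nat_Suc)
          finally show "norm (\<i> * complex_of_real x - u n x) \<le> x\<^sup>2 / 2 * inverse (real (Suc n))"
            by (simp add: norm_minus_commute)
        qed
        show "(\<lambda>n. x\<^sup>2 / 2 * inverse (real (Suc n))) \<longlonglongrightarrow> 0"
          using tendsto_mult[OF tendsto_const LIMSEQ_inverse_real_of_nat] by fastforce
      qed
    qed
  qed (use int in \<open>auto simp: u_def\<close>)
  moreover have "(\<lambda>n. \<integral>x. u n x \<partial>mu) \<longlonglongrightarrow> 0"
  proof (rule Lim_null_comparison)
    show "\<forall>\<^sub>F n in sequentially. norm (\<integral>x. u n x \<partial>mu) \<le> C * real (Suc n) powr (1 - \<gamma>)"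
    proof (rule always_eventually, rule allI)
      fix n
      have "norm (\<integral>x. u n x \<partial>mu) = real (Suc n) * norm (char mu (1 / real (Suc n)) - 1)"
        by (simp add: u_int norm_mult del: of_nat_Suc)
      also have "\<dots> \<le> real (Suc n) * (C * (1 / real (Suc n)) powr \<gamma>)"
        by (intro mult_left_mono le) auto
      also have "\<dots> = C * real (Suc n) powr (1 - \<gamma>)"
        by (simp add: powr_divide powr_diff del: of_nat_Suc)
      finally show "norm (\<integral>x. u n x \<partial>mu) \<le> C * real (Suc n) powr (1 - \<gamma>)" .
    qed
    have "(\<lambda>n. real n powr (1 - \<gamma>)) \<longlonglongrightarrow> 0"
      using \<gamma> by (intro tendsto_neg_powr filterlim_real_sequentially) auto
    from LIMSEQ_Suc[OF this] have "(\<lambda>n. C * real (Suc n) powr (1 - \<gamma>)) \<longlonglongrightarrow> C * 0"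
      by (intro tendsto_mult tendsto_const)
    then show "(\<lambda>n. C * real (Suc n) powr (1 - \<gamma>)) \<longlonglongrightarrow> 0" by simp
  qed
  ultimately have "(\<integral>x. \<i> * complex_of_real x \<partial>mu) = 0"
    by (rule LIMSEQ_unique)
  then show ?thesis by simp
qed

section \<open>Contraction in Wasserstein distance\<close>

text \<open>Undoes the root in \<open>wasserstein\<close>, so that the theorem compares infima of
  transport costs.\<close>

lemma ennpowr_root_power: "1 \<le> p \<Longrightarrow> ennpowr (ennpowr x (1 / p)) p = x"
  by (cases x) (auto simp: ennpowr_def powr_powr)

lemma mufun_finiteE:
  assumes "mufun M N A s < \<infinity>" "0 < s"
  obtains q where "0 \<le> q" "(\<integral>\<^sup>+\<omega>. (\<Sum>i<N. ennreal (A i \<omega> powr s)) \<partial>M) = ennreal q"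
    "Qfun M N A s = ereal (q - 1)" "mufun M N A s = ereal ((q - 1) / s)"
proof (cases "\<integral>\<^sup>+\<omega>. (\<Sum>i<N. ennreal (A i \<omega> powr s)) \<partial>M")
  case (real q)
  then have "Qfun M N A s = ereal (q - 1)"
    unfolding Qfun_def real(2) by (simp add: one_ereal_def)
  then show ?thesis
    using real assms by (intro that) (auto simp: mufun_def)
next
  case top
  then have "mufun M N A s = \<infinity>"
    unfolding mufun_def Qfun_def top using assms(2) by simp
  with assms show ?thesis by simp
qed

lemma INF_le_mult_INF:
  fixes f :: "'a \<Rightarrow> ennreal"
  assumes k: "0 < k" and le: "\<And>x. x \<in> S \<Longrightarrow> L \<le> ennreal k * f x"
  shows "L \<le> ennreal k * (INF x\<in>S. f x)"
proof -
  have inv: "ennreal (1 / k) * (ennreal k * y) = y" "ennreal k * (ennreal (1 / k) * y) = y" for y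
    using k by (simp_all add: mult.assoc[symmetric] ennreal_mult'[symmetric])
  have "ennreal (1 / k) * L \<le> (INF x\<in>S. f x)"
  proof (rule INF_greatest)
    fix x assume "x \<in> S"
    from mult_left_mono[OF le[OF this], of "ennreal (1 / k)"]
    show "ennreal (1 / k) * L \<le> f x" by (simp add: inv)
  qed
  from mult_left_mono[OF this, of "ennreal k"] show ?thesis by (simp add: inv)
qed

lemma symmetric_of_char:
  assumes mu: "real_distribution mu" and even: "\<And>\<xi>. char mu (- \<xi>) = char mu \<xi>"
  shows "distr mu borel uminus = mu"
proof -
  interpret real_distribution mu by fact
  have u: "(uminus :: real \<Rightarrow> real) \<in> borel_measurable mu" by measurable
  show ?thesis
  proof (rule Levy_uniqueness[OF real_distribution_distr[OF u] mu])
    show "char (distr mu borel uminus) = char mu"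
    proof
      fix \<xi>
      have "char (distr mu borel uminus) \<xi> = char mu (- \<xi>)"
        unfolding char_def by (subst integral_distr[OF u]) auto
      then show "char (distr mu borel uminus) \<xi> = char mu \<xi>" by (simp add: even)
    qed
  qed
qed

text \<open>If \<gamma> = 1 and the mean m of \<open>mu0\<close> exists, \<open>Vinf\<close> is the
  law of m * z with z of law \<open>zeta\<close>, and \<open>zeta\<close> has mean 1. In the other
  case with \<gamma> = 1 both marginals are symmetric. If \<gamma> > 1 both means are 0: that of
  \<open>mu0\<close> by assumption, that of \<open>Vinf\<close> because its characteristic function
  is 1 up to order \<xi>^\<gamma>.\<close>

lemma coupling_centered:
  assumes mu0: "real_distribution mu0" and \<gamma>: "1 \<le> \<gamma>" "\<gamma> < 2" and H: "H_gamma \<gamma> mu0 cp cm"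
    and zeta: "real_distribution zeta" and supp: "AE z in zeta. 0 \<le> z"
    and mean: "integrable zeta (\<lambda>z. z)" "integral\<^sup>L zeta (\<lambda>z. z) = 1"
    and Vinf: "real_distribution Vinf"
    and Vinf_char: "\<And>\<xi>. char Vinf \<xi> = (CLINT z|zeta. ghat \<gamma> mu0 cp cm (\<xi> * z powr (1 / \<gamma>)))"
    and \<pi>: "\<pi> \<in> couplings mu0 Vinf"
    and int: "integrable \<pi> (\<lambda>z. fst z - snd z)"
  shows "(\<integral>z. fst z - snd z \<partial>\<pi>) = 0"
proof -
  interpret Z: real_distribution zeta by fact
  have \<pi>: "prob_space \<pi>" "sets \<pi> = sets borel" "distr \<pi> borel fst = mu0" "distr \<pi> borel snd = Vinf"
    using \<pi> by (auto simp: couplings_def)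
  have [measurable]: "fst \<in> borel_measurable \<pi>" "snd \<in> borel_measurable \<pi>"
    by (simp_all add: measurable_cong_sets[OF \<pi>(2) refl] borel_prod[symmetric])
  \<comment> \<open>Integrability of the second marginal is inherited, writing Y = X - (X -
    Y).\<close>
  have means: "(\<integral>z. fst z - snd z \<partial>\<pi>) = (\<integral>x. x \<partial>mu0) - (\<integral>x. x \<partial>Vinf) \<and> integrable Vinf (\<lambda>x. x)"
    if "integrable mu0 (\<lambda>v. v)"
  proof -
    have i1: "integrable \<pi> fst"
      using that unfolding \<pi>(3)[symmetric] by (subst (asm) integrable_distr_eq) auto
    then have i2: "integrable \<pi> snd"
      using Bochner_Integration.integrable_diff[OF i1 int] by simp
    then show ?thesis
      using i1 unfolding \<pi>(3)[symmetric] \<pi>(4)[symmetric]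
      by (simp add: integral_distr integrable_distr_eq)
  qed
  consider (mean) "\<gamma> = 1" "integrable mu0 (\<lambda>v. v)" | (sym) "\<gamma> = 1" "\<not> integrable mu0 (\<lambda>v. v)" | (gt) "1 < \<gamma>"
    using \<gamma> by linarith
  then show ?thesis
  proof cases
    case mean': mean
    define m where "m = integral\<^sup>L mu0 (\<lambda>v. v)"
    have [measurable]: "(\<lambda>z. m * z) \<in> borel_measurable zeta" by measurable
    have "Vinf = distr zeta borel (\<lambda>z. m * z)"
    proof (rule Levy_uniqueness[OF Vinf Z.real_distribution_distr])
      show "char Vinf = char (distr zeta borel (\<lambda>z. m * z))"
      proof
        fix \<xi>
        have "char (distr zeta borel (\<lambda>z. m * z)) \<xi> = (\<integral>z. iexp (\<xi> * (m * z)) \<partial>zeta)"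
          unfolding char_def by (rule integral_distr) auto
        also have "\<dots> = (\<integral>z. exp (\<i> * complex_of_real (m * (\<xi> * z powr 1))) \<partial>zeta)"
          using supp by (intro integral_cong_AE) (auto elim!: eventually_mono simp: mult_ac)
        finally show "char Vinf \<xi> = char (distr zeta borel (\<lambda>z. m * z)) \<xi>"
          using mean' unfolding Vinf_char by (simp add: ghat_def m_def)
      qed
    qed simp
    then have "(\<integral>x. x \<partial>Vinf) = m"
      by (simp add: integral_distr mean)
    then show ?thesis using means[OF mean'(2)] by (simp add: m_def)
  next
    case sym
    then have "distr mu0 borel uminus = mu0"
      using H by (simp add: H_gamma_def)
    \<comment> \<open>In this branch \<open>ghat\<close> depends on the absolute value of its
      argument only.\<close>
    moreover have "distr Vinf borel uminus = Vinf"
      by (rule symmetric_of_char[OF Vinf]) (simp add: Vinf_char ghat_def sym abs_mult)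
    ultimately show ?thesis
      using int by (intro expectation_diff_symmetric \<pi>(1)) (simp_all add: \<pi>(3,4))
  next
    case gt
    then have tails: "((\<lambda>x. x powr \<gamma> * (1 - cdf mu0 x)) \<longlongrightarrow> cp) at_top" "((\<lambda>x. \<bar>x\<bar> powr \<gamma> * cdf mu0 x) \<longlongrightarrow> cm) at_bot"
      and mean0: "integral\<^sup>L mu0 (\<lambda>v. v) = 0"
      using H by (auto simp: H_gamma_def)
    have int0: "integrable mu0 (\<lambda>v. v)"
      by (rule integrable_of_powr_tails[OF mu0 gt tails])
    have \<gamma>0: "0 < \<gamma>" using \<gamma> by simp
    obtain \<kappa> where \<kappa>: "\<And>x. 0 \<le> Re (\<kappa> x)"
      "\<And>\<xi>. ghat \<gamma> mu0 cp cm \<xi> = exp (- (\<kappa> (sgn \<xi>) * complex_of_real (\<bar>\<xi>\<bar> powr \<gamma>)))"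
      by (rule ghat_eq_exp[OF \<gamma>0 \<gamma>(2) H], rule that)
    have "(\<integral>x. x \<partial>Vinf) = 0"
    proof (rule mean_zero_of_char[OF Vinf _ gt])
      show "integrable Vinf (\<lambda>x. x)" using means[OF int0] by simp
      fix \<xi> :: real assume \<xi>: "0 < \<xi>"
      have "char Vinf \<xi> = laplace zeta (\<kappa> (sgn \<xi>) * complex_of_real (\<bar>\<xi>\<bar> powr \<gamma>))"
        unfolding Vinf_char using \<gamma> by (intro integral_ghat_eq_laplace[OF zeta supp _ \<kappa>(2)]) simp
      also have "norm (\<dots> - 1) \<le> norm (\<kappa> (sgn \<xi>) * complex_of_real (\<bar>\<xi>\<bar> powr \<gamma>)) * (\<integral>x. \<bar>x\<bar> \<partial>zeta)"
        using \<kappa>(1) by (intro laplace_minus_one_le zeta mean(1)) simp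
      also have "\<dots> = norm (\<kappa> 1) * (\<integral>x. \<bar>x\<bar> \<partial>zeta) * \<xi> powr \<gamma>"
        using \<xi> by (simp add: norm_mult)
      finally show "norm (char Vinf \<xi> - 1) \<le> norm (\<kappa> 1) * (\<integral>x. \<bar>x\<bar> \<partial>zeta) * \<xi> powr \<gamma>" .
    qed
    then show ?thesis using means[OF int0] mean0 by simp
  qed
qed

theorem theorem3:
  fixes M :: "'a measure" and N :: nat and A :: "nat \<Rightarrow> 'a \<Rightarrow> real"
    and \<gamma> \<delta> cp cm :: real
    and mu0 :: "real measure" and V :: "real \<Rightarrow> real measure"
    and zeta :: "real measure" and Vinf :: "real measure"
  assumes M: "prob_space M"
    and N: "N \<ge> 2"
    and A_meas: "\<And>i. i < N \<Longrightarrow> A i \<in> borel_measurable M"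
    and A_nonneg: "\<And>i \<omega>. i < N \<Longrightarrow> \<omega> \<in> space M \<Longrightarrow> A i \<omega> \<ge> 0"
    and A1: "measure M {\<omega> \<in> space M. card {i. i < N \<and> A i \<omega> > 0} \<in> {0, 1}} < 1"
    and A2: "integral\<^sup>L M (\<lambda>\<omega>. real (card {i. i < N \<and> A i \<omega> > 0})) > 1"
    and A3: "measure M {\<omega> \<in> space M. \<forall>i<N. A i \<omega> \<in> {0, 1}} < 1"
    and mu0: "real_distribution mu0"
    and gamma: "0 < \<gamma>" "\<gamma> < 2"
    and H: "H_gamma \<gamma> mu0 cp cm"
    and delta: "\<delta> > \<gamma>" "(1 \<le> \<gamma> \<and> \<delta> \<le> 2) \<or> \<delta> \<le> 1"
    and mu_fin: "mufun M N A \<gamma> < \<infinity>"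
    and mu_less: "mufun M N A \<delta> < mufun M N A \<gamma>"
    and V_distr: "\<And>t. t \<ge> 0 \<Longrightarrow> real_distribution (V t)"
    and V_ode: "\<And>t \<xi>. t \<ge> 0 \<Longrightarrow>
        ((\<lambda>s. char (V s) \<xi>) has_vector_derivative
           (- char (V t) \<xi> + integral\<^sup>L M (\<lambda>\<omega>. \<Prod>i<N. char (V t) (A i \<omega> * \<xi>))))
        (at t within {0..})"
    and V_init: "\<And>\<xi>. char (V 0) \<xi> = char mu0 \<xi>"
    and zeta: "real_distribution zeta"
    and zeta_supp: "measure zeta {0..} = 1"
    and zeta_mean: "integrable zeta (\<lambda>z. z)" "integral\<^sup>L zeta (\<lambda>z. z) = 1"
    and zeta_eq: "\<And>\<xi>. char zeta \<xi> =
        set_lebesgue_integral lborel {0..1::real}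
          (\<lambda>\<tau>. integral\<^sup>L M (\<lambda>\<omega>. \<Prod>i<N.
               char zeta (\<xi> * A i \<omega> powr \<gamma> * \<tau> powr real_of_ereal (Qfun M N A \<gamma>))))"
    and Vinf: "real_distribution Vinf"
    and Vinf_char: "\<And>\<xi>. char Vinf \<xi> =
        (CLINT z|zeta. ghat \<gamma> mu0 cp cm (\<xi> * z powr (1 / \<gamma>)))"
    and t: "t \<ge> 0"
  shows "ennpowr (wasserstein \<delta>
                    (distr (V t) borel (\<lambda>x. exp (- real_of_ereal (mufun M N A \<gamma>) * t) * x)) Vinf)
                 (max \<delta> 1)
         \<le> ennreal (if \<delta> \<le> 1 then 1 else 2) *
           ennpowr (wasserstein \<delta> mu0 Vinf) (max \<delta> 1) *
           ennreal (exp (- t * \<delta> * (real_of_ereal (mufun M N A \<gamma>) - real_of_ereal (mufun M N A \<delta>))))"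
proof -
  interpret M: prob_space M by fact
  interpret mu0: real_distribution mu0 by fact
  interpret Vinf: real_distribution Vinf by fact
  interpret zeta: real_distribution zeta by fact
  interpret Vt: real_distribution "V t" by (rule V_distr[OF t])
  have \<delta>: "0 < \<delta>" "\<delta> \<le> 2" using gamma delta by auto
  have \<mu>\<delta>_fin: "mufun M N A \<delta> < \<infinity>" using mu_less mu_fin by (rule less_trans)
  obtain q\<^sub>\<gamma> where q\<gamma>: "0 \<le> q\<^sub>\<gamma>" "Qfun M N A \<gamma> = ereal (q\<^sub>\<gamma> - 1)" "mufun M N A \<gamma> = ereal ((q\<^sub>\<gamma> - 1) / \<gamma>)"
    using mufun_finiteE[OF mu_fin gamma(1)] by metis
  obtain q where q: "0 \<le> q" "(\<integral>\<^sup>+\<omega>. (\<Sum>i<N. ennreal (A i \<omega> powr \<delta>)) \<partial>M) = ennreal q"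
    "mufun M N A \<delta> = ereal ((q - 1) / \<delta>)"
    using mufun_finiteE[OF \<mu>\<delta>_fin \<delta>(1)] by metis
  define Q where "Q = q\<^sub>\<gamma> - 1"
  define \<mu> where "\<mu> = Q / \<gamma>"
  have \<mu>: "real_of_ereal (mufun M N A \<gamma>) = \<mu>" by (simp add: q\<gamma> \<mu>_def Q_def)
  have supp: "AE z in zeta. 0 \<le> z"
  proof -
    have "AE z in zeta. z \<in> {0..}"
      using zeta_supp by (intro zeta.AE_prob_1) auto
    then show ?thesis by simp
  qed
  obtain \<kappa> where \<kappa>: "\<And>x. 0 \<le> Re (\<kappa> x)"
    "\<And>\<xi>. ghat \<gamma> mu0 cp cm \<xi> = exp (- (\<kappa> (sgn \<xi>) * complex_of_real (\<bar>\<xi>\<bar> powr \<gamma>)))"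
    by (rule ghat_eq_exp[OF gamma H], rule that)
  have Vinf_laplace: "char Vinf \<xi> = laplace zeta (\<kappa> (sgn \<xi>) * complex_of_real (\<bar>\<xi>\<bar> powr \<gamma>))" for \<xi>
    unfolding Vinf_char by (rule integral_ghat_eq_laplace[OF zeta supp gamma(1) \<kappa>(2)])
  have zeta_eq': "char zeta \<xi> = set_lebesgue_integral lborel {0..1::real}
          (\<lambda>\<tau>. integral\<^sup>L M (\<lambda>\<omega>. \<Prod>i<N. char zeta (\<xi> * A i \<omega> powr \<gamma> * \<tau> powr Q)))" for \<xi>
    using zeta_eq[of \<xi>] by (simp add: q\<gamma>(2) Q_def)
  have Vinf_fp: "char Vinf \<xi> = (\<integral>\<tau>. \<integral>\<omega>. (\<Prod>i<N. char Vinf (A i \<omega> * \<tau> powr \<mu> * \<xi>)) \<partial>M \<partial>uniform01)" for \<xi>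
    unfolding \<mu>_def
    by (rule char_fixed_point[OF gamma(1) A_nonneg laplace_fixed_point[OF M A_meas zeta supp zeta_eq'] \<kappa>(1) Vinf_laplace])
  note Vinf_mild = char_mild_solution[OF M A_meas Vinf.char_measurable Vinf.cmod_char_le_1 Vinf_fp]
  note V_mild = mild_solution[OF M A_meas V_distr V_ode]
  define c :: real where "c = (if \<delta> \<le> 1 then 1 else 2)"
  define r where "r = exp (- t)"
  have r: "0 < r" "r \<le> 1" using t by (simp_all add: r_def)
  have r_\<mu>: "r powr - \<mu> = exp (\<mu> * t)" by (simp add: r_def powr_def)
  define E where "E = exp (- t * \<delta> * (real_of_ereal (mufun M N A \<gamma>) - real_of_ereal (mufun M N A \<delta>)))"
  \<comment> \<open>The rate splits into exp (-\<mu> \<delta> t) from rescaling space and exp ((q -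
    1) t) from the growth of the tree moment.\<close>
  have E: "E = exp (- \<mu> * t) powr \<delta> * r powr (1 - q)"
    using \<delta> unfolding E_def \<mu> r_def powr_def by (simp add: q(3) exp_add[symmetric] field_simps)
  define V' where "V' = distr (V t) borel (\<lambda>x. exp (- \<mu> * t) * x)"
  have step: "(INF \<pi>\<in>couplings V' Vinf. \<integral>\<^sup>+z. ennreal (\<bar>fst z - snd z\<bar> powr \<delta>) \<partial>\<pi>)
      \<le> ennreal (c * E) * (\<integral>\<^sup>+z. ennreal (\<bar>fst z - snd z\<bar> powr \<delta>) \<partial>\<pi>)"
    if \<pi>: "\<pi> \<in> couplings mu0 Vinf" for \<pi>
  proof (cases "\<integral>\<^sup>+z. ennreal (\<bar>fst z - snd z\<bar> powr \<delta>) \<partial>\<pi>")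
    \<comment> \<open>A coupling of infinite cost bounds anything, as c * E > 0.\<close>
    case top
    have "0 < c * E" by (simp add: c_def E_def)
    then have "ennreal (c * E) * \<top> = \<top>" by (simp only: ennreal_mult_top) auto
    then show ?thesis by (simp add: top)
  next
    case (real K)
    have \<pi>': "prob_space \<pi>" "sets \<pi> = sets borel" "distr \<pi> borel fst = mu0" "distr \<pi> borel snd = Vinf"
      using \<pi> by (auto simp: couplings_def)
    \<comment> \<open>Each leaf draws its pair (X, Y) from the given coupling, so \<open>fst\<close>
      and \<open>snd\<close> yield both tree sums on one sample space.\<close>
    interpret T: random_tree M N A \<pi>
      using N by (intro random_tree.intro M \<pi>'(1) A_meas) auto
    have fst_meas [measurable]: "fst \<in> borel_measurable \<pi>" and snd_meas [measurable]: "snd \<in> borel_measurable \<pi>"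
      by (simp_all add: measurable_cong_sets[OF \<pi>'(2) refl] borel_prod[symmetric])
    have centered: "integrable \<pi> (\<lambda>z. fst z - snd z) \<and> (\<integral>z. fst z - snd z \<partial>\<pi>) = 0" if "1 < \<delta>"
    proof -
      have "integrable \<pi> (\<lambda>z. \<bar>fst z - snd z\<bar> powr \<delta>)"
        using real by (intro integrableI_nonneg) auto
      then have "integrable \<pi> (\<lambda>z. 1 + \<bar>fst z - snd z\<bar> powr \<delta>)"
        by simp
      then have int: "integrable \<pi> (\<lambda>z. fst z - snd z)"
      proof (rule Bochner_Integration.integrable_bound)
        have "\<bar>x\<bar> \<le> 1 + \<bar>x\<bar> powr \<delta>" for x :: real
        proof (cases "\<bar>x\<bar> \<le> 1")
          case False
          then have "\<bar>x\<bar> powr 1 \<le> \<bar>x\<bar> powr \<delta>" using that by (intro powr_mono) auto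
          then show ?thesis by simp
        qed (simp add: add_increasing2)
        then show "AE z in \<pi>. norm (fst z - snd z) \<le> norm (1 + \<bar>fst z - snd z\<bar> powr \<delta>)"
          by (intro AE_I2) simp
      qed measurable
      have "1 \<le> \<gamma>" using delta that by simp
      with int show ?thesis
        using coupling_centered[OF mu0 _ gamma(2) H zeta supp zeta_mean Vinf Vinf_char \<pi>] by simp
    qed
    have leaf: "(\<integral>\<^sup>+p. ennreal (\<bar>z + (fst p - snd p)\<bar> powr \<delta>) \<partial>\<pi>) \<le> ennreal (\<bar>z\<bar> powr \<delta> + c * K)" for z
      unfolding c_def using real centered
      by (intro prob_space.nn_integral_powr_add_le[OF \<pi>'(1)] \<delta>) auto
    have "char (distr T.samples borel (T.tree_limit fst r)) = (\<lambda>\<xi>. char (V (- ln r)) \<xi>)"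
    proof (rule T.char_tree_limit[where w="\<lambda>r \<xi>. char (V (- ln r)) \<xi>", OF fst_meas r])
      fix r :: real and \<xi> assume r: "0 < r" "r \<le> 1"
      then have r0: "0 \<le> - ln r" by simp
      show "norm (char (V (- ln r)) \<xi>) \<le> 1"
        by (rule real_distribution.cmod_char_le_1[OF V_distr[OF r0]])
      show "(\<lambda>\<omega>. \<Prod>i<N. char (V (- ln r)) (A i \<omega> * \<xi>)) \<in> borel_measurable M"
        using real_distribution.char_measurable[OF V_distr[OF r0]] A_meas
        by (intro borel_measurable_prod measurable_compose[of _ M borel "char (V (- ln r))"]) auto
      show "(\<lambda>\<tau>. indicator {r..1} \<tau> *\<^sub>R (\<integral>\<omega>. (\<Prod>i<N. char (V (- ln (r / \<tau>))) (A i \<omega> * \<xi>)) \<partial>M)) \<in> borel_measurable borel"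
        by (rule V_mild(1)[OF _ _ _ r])
      have "(\<integral>p. iexp (\<xi> * fst p) \<partial>\<pi>) = char (distr \<pi> borel fst) \<xi>"
        unfolding char_def by (subst integral_distr) auto
      then show "char (V (- ln r)) \<xi> = r *\<^sub>R (\<integral>p. iexp (\<xi> * fst p) \<partial>\<pi>) +
        set_lebesgue_integral lborel {r..1} (\<lambda>\<tau>. \<integral>\<omega>. (\<Prod>i<N. char (V (- ln (r / \<tau>))) (A i \<omega> * \<xi>)) \<partial>M)"
        using V_mild(2)[OF _ _ _ r] by (simp add: V_init \<pi>'(3))
    qed
    then have X_law: "distr T.samples borel (T.tree_limit fst r) = V t"
      by (intro Levy_uniqueness T.samples.real_distribution_distr Vt.real_distribution_axioms) (simp_all add: r_def)
    have Y_char: "char (distr T.samples borel (T.tree_limit snd r)) = (\<lambda>\<xi>. char Vinf (r powr - \<mu> * \<xi>))"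
    proof (rule T.char_tree_limit[where w="\<lambda>r \<xi>. char Vinf (r powr - \<mu> * \<xi>)", OF snd_meas r])
      fix r :: real and \<xi> assume r: "0 < r" "r \<le> 1"
      show "norm (char Vinf (r powr - \<mu> * \<xi>)) \<le> 1"
        by (rule Vinf.cmod_char_le_1)
      show "(\<lambda>\<omega>. \<Prod>i<N. char Vinf (r powr - \<mu> * (A i \<omega> * \<xi>))) \<in> borel_measurable M"
        using Vinf.char_measurable A_meas
        by (intro borel_measurable_prod measurable_compose[of _ M borel "char Vinf"]) auto
      show "(\<lambda>\<tau>. indicator {r..1} \<tau> *\<^sub>R (\<integral>\<omega>. (\<Prod>i<N. char Vinf ((r / \<tau>) powr - \<mu> * (A i \<omega> * \<xi>))) \<partial>M)) \<in> borel_measurable borel"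
        by (rule Vinf_mild(1)[OF _ r])
      have "(\<integral>p. iexp (\<xi> * snd p) \<partial>\<pi>) = char (distr \<pi> borel snd) \<xi>"
        unfolding char_def by (subst integral_distr) auto
      then show "char Vinf (r powr - \<mu> * \<xi>) = r *\<^sub>R (\<integral>p. iexp (\<xi> * snd p) \<partial>\<pi>) +
        set_lebesgue_integral lborel {r..1} (\<lambda>\<tau>. \<integral>\<omega>. (\<Prod>i<N. char Vinf ((r / \<tau>) powr - \<mu> * (A i \<omega> * \<xi>))) \<partial>M)"
        using Vinf_mild(2)[OF _ r] by (simp add: \<pi>'(4))
    qed
    \<comment> \<open>The second tree sum has the law of exp (\<mu> t) times a variable of law
      \<open>Vinf\<close>. Multiplying by \<open>e\<close> restores \<open>Vinf\<close> and turns
      the first sum into the rescaled solution.\<close>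
    define e where "e = exp (- \<mu> * t)"
    have e0: "0 < e" by (simp add: e_def)
    define X Y where "X x = e * T.tree_limit fst r x" and "Y x = e * T.tree_limit snd r x" for x
    have X [measurable]: "X \<in> borel_measurable T.samples" and Y [measurable]: "Y \<in> borel_measurable T.samples"
      unfolding X_def Y_def by measurable
    have "V' = distr (distr T.samples borel (T.tree_limit fst r)) borel (\<lambda>x. e * x)"
      by (simp add: V'_def X_law e_def)
    also have "\<dots> = distr T.samples borel X"
      by (subst distr_distr) (auto simp: comp_def X_def[abs_def])
    finally have X': "distr T.samples borel X = V'" ..
    have Y': "distr T.samples borel Y = Vinf"
    proof (rule Levy_uniqueness[OF T.samples.real_distribution_distr[OF Y] Vinf], rule ext)
      fix \<xi>
      have "char (distr T.samples borel Y) \<xi> = (\<integral>x. iexp (\<xi> * Y x) \<partial>T.samples)"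
        unfolding char_def by (rule integral_distr) auto
      also have "\<dots> = char (distr T.samples borel (T.tree_limit snd r)) (\<xi> * e)"
        unfolding char_def by (subst integral_distr) (auto simp: Y_def mult_ac)
      also have "\<dots> = char Vinf (r powr - \<mu> * (\<xi> * e))" by (simp add: Y_char)
      also have "r powr - \<mu> * (\<xi> * e) = \<xi>"
        by (simp add: r_\<mu> e_def exp_minus)
      finally show "char (distr T.samples borel Y) \<xi> = char Vinf \<xi>" .
    qed
    define \<rho> where "\<rho> = distr T.samples borel (\<lambda>x. (X x, Y x))"
    have XY [measurable]: "(\<lambda>x. (X x, Y x)) \<in> borel_measurable T.samples" by measurable
    have borel_fst_snd [measurable]: "fst \<in> borel_measurable (borel :: (real \<times> real) measure)"
      "snd \<in> borel_measurable (borel :: (real \<times> real) measure)"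
      by (simp_all add: borel_prod[symmetric])
    have "\<rho> \<in> couplings V' Vinf"
      unfolding couplings_def \<rho>_def
      by (auto intro!: T.samples.prob_space_distr simp: distr_distr comp_def X' Y' eta_contract_eq)
    then have "(INF \<pi>\<in>couplings V' Vinf. \<integral>\<^sup>+z. ennreal (\<bar>fst z - snd z\<bar> powr \<delta>) \<partial>\<pi>)
      \<le> (\<integral>\<^sup>+z. ennreal (\<bar>fst z - snd z\<bar> powr \<delta>) \<partial>\<rho>)"
      by (rule INF_lower)
    also have "\<dots> = (\<integral>\<^sup>+x. ennreal (\<bar>X x - Y x\<bar> powr \<delta>) \<partial>T.samples)"
      unfolding \<rho>_def by (subst nn_integral_distr) auto
    also have "\<dots> = (\<integral>\<^sup>+x. ennreal (e powr \<delta>) * ennreal (\<bar>T.tree_limit fst r x - T.tree_limit snd r x\<bar> powr \<delta>) \<partial>T.samples)"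
    proof (intro nn_integral_cong)
      fix x
      have "\<bar>X x - Y x\<bar> = e * \<bar>T.tree_limit fst r x - T.tree_limit snd r x\<bar>"
        using e0 by (simp add: X_def Y_def right_diff_distrib[symmetric] abs_mult)
      then show "ennreal (\<bar>X x - Y x\<bar> powr \<delta>) = ennreal (e powr \<delta>) * ennreal (\<bar>T.tree_limit fst r x - T.tree_limit snd r x\<bar> powr \<delta>)"
        using e0 by (simp add: powr_mult ennreal_mult'[symmetric])
    qed
    also have "\<dots> = ennreal (e powr \<delta>) * (\<integral>\<^sup>+x. ennreal (\<bar>T.tree_limit fst r x - T.tree_limit snd r x\<bar> powr \<delta>) \<partial>T.samples)"
      by (rule nn_integral_cmult) measurable
    also have "\<dots> \<le> ennreal (e powr \<delta>) * ennreal (c * K * r powr (1 - q))"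
      using real by (intro mult_left_mono T.tree_limit_moment fst_meas snd_meas r \<delta> A_nonneg q leaf) (auto simp: c_def)
    also have "\<dots> = ennreal (c * E) * ennreal K"
      using real by (simp add: E e_def c_def ennreal_mult'[symmetric] mult_ac)
    finally show ?thesis by (simp add: real)
  qed
  have p: "1 \<le> max \<delta> 1" by simp
  \<comment> \<open>The bound holds for every coupling of the initial laws; taking the infimum over
    them avoids any need for an optimal one.\<close>
  have "ennpowr (wasserstein \<delta> V' Vinf) (max \<delta> 1) \<le> ennreal (c * E) * ennpowr (wasserstein \<delta> mu0 Vinf) (max \<delta> 1)"
    unfolding wasserstein_def ennpowr_root_power[OF p]
    by (intro INF_le_mult_INF step) (simp add: c_def E_def)
  also have "\<dots> = ennreal c * ennpowr (wasserstein \<delta> mu0 Vinf) (max \<delta> 1) * ennreal E"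
    by (simp add: c_def E_def ennreal_mult mult_ac)
  finally show ?thesis
    unfolding V'_def c_def E_def \<mu> .
qed

end
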